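(* For any sequence $\{a_n\}_{n\ge 1}$ in the class $\mathcal{A}_{\mathrm{ST}}$, the estimate $$\sum_{n\le x} a_n = o\left(\sum_{n\le x}|a_n|\right)$$ holds as $x\to\infty$.
   Context: $\mathcal{A}_{\mathrm{ST}}$ denotes the class of infinite sequences $\{a_n\}_{n\ge 1}$ of real numbers satisfying the following three properties. (1) Multiplicativity: $a_{mn}=a_m a_n$ for any coprime positive integers $m,n$. (2) Sato--Tate distribution: for any prime $p$ we have $a_p\in[-2,2]$, and for the angles $\vartheta_p\in[0,\pi)$ defined by $a_p=2\cos\vartheta_p$ and any $\alpha\in[0,\pi)$, $$\frac{\#\{p\le x : p \text{ prime},\ \vartheta_p\in[0,\alpha]\}}{\pi(x)}\to \frac{2}{\pi}\int_0^\alpha \sin^2\vartheta\,d\vartheta\quad (x\to\infty),$$ where $\pi(x)$ is the number of primes $p\le x$. (3) Growth on prime powers: there exists a constant $\varrho>0$ such that for any integer $a\ge 2$ and any prime $p$ we have $|a_{p^a}|\le p^{(a-1)/2-\varrho}$. *)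

theory Defs
  imports
    "HOL-Analysis.Analysis"
    "HOL-Library.Landau_Symbols"
    "HOL-Computational_Algebra.Primes"
begin

text \<open>
  A sequence $(a_n)_{n \ge 1}$ of reals is a function of type \<^typ>\<open>nat \<Rightarrow> real\<close> whose value at
  \<open>0\<close> is junk: nothing below depends on it.
\<close>

definition multiplicative_seq :: "(nat \<Rightarrow> real) \<Rightarrow> bool" where
  "multiplicative_seq a \<longleftrightarrow>
     (\<forall>m n. 0 < m \<longrightarrow> 0 < n \<longrightarrow> coprime m n \<longrightarrow> a (m * n) = a m * a n)"

definition prime_pi :: "real \<Rightarrow> nat" where
  "prime_pi x = card {p :: nat. prime p \<and> real p \<le> x}"

text \<open>
  For $a_p \in [-2,2]$, this is the unique angle $\vartheta_p \in [0,\pi]$ with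
  $a_p = 2\cos\vartheta_p$. The value $\pi$ occurs exactly when $a_p = -2$; such primes are
  permitted, and they lie in none of the sets $\{p : \vartheta_p \in [0,\alpha]\}$ with
  $\alpha < \pi$.
\<close>

definition ST_angle :: "(nat \<Rightarrow> real) \<Rightarrow> nat \<Rightarrow> real" where
  "ST_angle a p = arccos (a p / 2)"

lemma ST_angle_eq_iff:
  assumes "a p \<in> {-2..2}"
  shows "ST_angle a p = \<theta> \<longleftrightarrow> \<theta> \<in> {0..pi} \<and> a p = 2 * cos \<theta>"
proof -
  have "-1 \<le> a p / 2" "a p / 2 \<le> 1"
    using assms by auto
  then show ?thesis
    unfolding ST_angle_def by (auto simp: arccos_lbound arccos_ubound arccos_cos)
qed

definition sato_tate_distributed :: "(nat \<Rightarrow> real) \<Rightarrow> bool" where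
  "sato_tate_distributed a \<longleftrightarrow>
     (\<forall>p. prime p \<longrightarrow> a p \<in> {-2..2}) \<and>
     (\<forall>\<alpha>\<in>{0..<pi}.
        ((\<lambda>x :: real. real (card {p. prime p \<and> real p \<le> x \<and> ST_angle a p \<in> {0..\<alpha>}})
                        / real (prime_pi x))
           \<longlongrightarrow> 2 / pi * integral {0..\<alpha>} (\<lambda>\<theta>. (sin \<theta>)\<^sup>2)) at_top)"

definition prime_power_growth :: "(nat \<Rightarrow> real) \<Rightarrow> bool" where
  "prime_power_growth a \<longleftrightarrow>
     (\<exists>\<rho> > 0. \<forall>k \<ge> 2. \<forall>p. prime p \<longrightarrow>
        \<bar>a (p ^ k)\<bar> \<le> real p powr ((real k - 1) / 2 - \<rho>))"

definition A_ST :: "(nat \<Rightarrow> real) set" where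
  "A_ST = {a. multiplicative_seq a \<and> sato_tate_distributed a \<and> prime_power_growth a}"

end

theory Submission
  imports Defs
begin

text \<open>
  Write \<open>A N\<close> for the sum of \<open>\<bar>a n\<bar>\<close> and \<open>L N\<close> for the sum of \<open>\<bar>a n\<bar> / n\<close>, both over
  \<open>1 \<le> n \<le> N\<close>. The proof compares \<open>a\<close> with \<open>\<bar>a\<bar>\<close> by weighting with a logarithm, in the
  manner of Chebyshev and Wirsing. Expanding \<open>ln n\<close> over the prime powers dividing \<open>n\<close> and using
  multiplicativity gives, for \<open>f = a\<close> and for \<open>f = \<bar>a\<bar>\<close>,
  \[ \sum_{n \le N} f(n) \ln n = \sum_{m \le N} f(m) \sum_{p \le N/m} f(p) \ln p + \mbox{error}, \]
  so that only the behaviour of \<open>f\<close> on primes matters, and there the Sato--Tate law applies.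

  For \<open>f = a\<close> the law is symmetric under \<open>\<theta> \<mapsto> \<pi> - \<theta>\<close>, so \<open>a\<close> has mean value zero on the
  primes, and with Chebyshev's upper bound the inner sum is at most \<open>\<epsilon> N / m + C\<close> in absolute value
  (\<open>sato_tate_weighted_mean_zero\<close>). Hence the main term on the right is at most \<open>\<epsilon> N L N + C A N\<close> for every
  \<open>\<epsilon> > 0\<close>; this notion of smallness is \<open>negligible_for\<close>. Replacing \<open>ln n\<close> by
  \<open>ln N\<close> costs \<open>ln (N / n) \<le> \<epsilon> N / n + C\<close> per term, which is equally negligible, so
  \<open>ln N\<close> times the sum of \<open>a\<close> is negligible (\<open>negligible_for_sum_times_log\<close>).

  For \<open>f = \<bar>a\<bar>\<close> a positive proportion of the primes has \<open>\<bar>a p\<bar> \<ge> 1\<close>, so by Chebyshev's lower bound the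
  inner sum is at least \<open>c N / m - C\<close>. Since \<open>ln n \<le> ln N\<close>, this yields
  \<open>N L N \<le> K (ln N + 1) A N\<close> (\<open>abs_log_sum_le\<close>). Inserting it into the previous
  bound and dividing by \<open>ln N\<close> shows that the sum of \<open>a\<close> is at most \<open>\<epsilon> A N\<close> in absolute value for large \<open>N\<close>.

  The error term comes only from the prime powers \<open>p ^ k\<close> with \<open>k \<ge> 2\<close>. Their
  weights, divided by \<open>p ^ k\<close>, have a convergent sum by the growth condition, and a convergent sum has small
  tails: the tail contributes \<open>\<epsilon> N L N\<close> and the finitely many remaining prime powers contribute \<open>C A N\<close>
  (\<open>negligible_for_dilations\<close>).
\<close>

section \<open>Chebyshev's bounds for the prime counting function\<close>

definition primes_upto :: "nat \<Rightarrow> nat set" where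
  "primes_upto n = {p. prime p \<and> p \<le> n}"

lemma finite_primes_upto [simp, intro]: "finite (primes_upto n)"
  by (rule finite_subset[of _ "{..n}"]) (auto simp: primes_upto_def)

lemma primes_uptoD:
  assumes "p \<in> primes_upto n"
  shows "prime p" "p \<le> n" "2 \<le> p" "0 < p" "0 \<le> ln (real p)"
proof -
  show "prime p" "p \<le> n" using assms by (auto simp: primes_upto_def)
  then show "2 \<le> p" by (simp add: prime_ge_2_nat)
  then show "0 < p" "0 \<le> ln (real p)" by auto
qed

lemma primes_upto_mono: "m \<le> n \<Longrightarrow> primes_upto m \<subseteq> primes_upto n"
  by (auto simp: primes_upto_def)

lemma prime_pi_of_nat: "prime_pi (real n) = card (primes_upto n)"
  by (simp add: prime_pi_def primes_upto_def)

lemma prod_primes_dvd: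
  fixes P :: "nat set"
  assumes "finite P" "\<And>p. p \<in> P \<Longrightarrow> prime p" "\<And>p. p \<in> P \<Longrightarrow> p dvd m"
  shows "\<Prod>P dvd m"
  using assms
proof (induction P rule: finite_induct)
  case (insert q P)
  have "coprime q (\<Prod>P)"
    by (rule prod_coprime_right) (use insert in \<open>auto intro!: primes_coprime\<close>)
  then show ?case
    using insert by (auto intro!: divides_mult)
qed simp

text \<open>
  A prime in \<open>(\<lceil>n / 2\<rceil>, n]\<close> divides \<open>n!\<close> but neither of the two factorials in the denominator of the
  middle binomial coefficient. Taking the interval relative to \<open>n - n div 2\<close> treats even and odd \<open>n\<close> alike.
\<close>

lemma prod_upper_half_primes_dvd_binomial:
  "\<Prod>(primes_upto n - primes_upto (n - n div 2)) dvd n choose (n div 2)"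
proof (rule prod_primes_dvd)
  show "\<And>p. p \<in> primes_upto n - primes_upto (n - n div 2) \<Longrightarrow> p dvd n choose (n div 2)"
  proof -
    fix p assume p: "p \<in> primes_upto n - primes_upto (n - n div 2)"
    then have pr: "prime p" "p \<le> n" "n - n div 2 < p"
      by (auto simp: primes_upto_def)
    have "fact (n div 2) * fact (n - n div 2) * (n choose (n div 2)) = (fact n :: nat)"
      by (rule binomial_fact_lemma) simp
    moreover have "p dvd (fact n :: nat)"
      using pr by (simp add: prime_dvd_fact_iff)
    moreover have "\<not> p dvd (fact (n div 2) :: nat)" "\<not> p dvd (fact (n - n div 2) :: nat)"
      using pr by (simp_all add: prime_dvd_fact_iff)
    ultimately show "p dvd n choose (n div 2)"
      by (metis pr(1) prime_dvd_mult_nat)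
  qed
qed (auto simp: primes_upto_def)

text \<open>
  The middle binomial coefficient is at most \<open>2 ^ n\<close>, which bounds the contribution of the primes
  above \<open>\<lceil>n / 2\<rceil>\<close>; halving repeatedly gives a geometric series. The constant \<open>3\<close> leaves room for the
  rounding of odd \<open>n\<close>: the induction needs \<open>n \<le> 3 (n div 2)\<close>.
\<close>

lemma sum_ln_primes_le: "(\<Sum>p\<in>primes_upto n. ln (real p)) \<le> 3 * real n"
proof (induction n rule: less_induct)
  case (less n)
  show ?case
  proof (cases "n \<le> 1")
    case True
    have "\<not> prime p" if "p \<le> n" for p
      using that True prime_ge_2_nat[of p] by auto
    then have "primes_upto n = {}"
      by (auto simp: primes_upto_def)
    then show ?thesis by simp
  next
    case False
    define m where "m = n - n div 2"
    have m: "m < n" "m \<le> n" using False by (auto simp: m_def)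
    define D where "D = primes_upto n - primes_upto m"
    have "\<Prod>D \<le> n choose (n div 2)"
      unfolding D_def m_def
      by (rule dvd_imp_le[OF prod_upper_half_primes_dvd_binomial]) simp
    also have "\<dots> \<le> 2 ^ n" by (rule binomial_le_pow2)
    finally have "real (\<Prod>D) \<le> 2 ^ n"
      by (metis of_nat_le_iff of_nat_numeral of_nat_power)
    moreover have pos: "\<And>p. p \<in> D \<Longrightarrow> 0 < p"
      by (auto simp: D_def primes_upto_def prime_gt_0_nat)
    have "real (\<Prod>D) > 0"
      unfolding of_nat_prod by (intro prod_pos) (use pos in auto)
    ultimately have "ln (real (\<Prod>D)) \<le> real n * ln 2"
      by (metis ln_le_cancel_iff ln_realpow zero_less_numeral zero_less_power)
    moreover have "ln (real (\<Prod>D)) = (\<Sum>p\<in>D. ln (real p))"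
      unfolding of_nat_prod by (rule ln_prod) (use pos in \<open>auto simp: D_def\<close>)
    moreover have "(\<Sum>p\<in>primes_upto n. ln (real p))
        = (\<Sum>p\<in>D. ln (real p)) + (\<Sum>p\<in>primes_upto m. ln (real p))"
      unfolding D_def by (rule sum.subset_diff) (use m primes_upto_mono in auto)
    moreover have "real n * ln 2 \<le> real n * 1"
      using ln_2_less_1 by (intro mult_left_mono) auto
    moreover have "n \<le> 3 * (n - m)"
      using False unfolding m_def by linarith
    ultimately show ?thesis
      using less.IH[OF m(1)] m by linarith
  qed
qed

lemma card_primes_upto_sqrt_le: "real (card {p \<in> primes_upto n. p\<^sup>2 \<le> n}) \<le> sqrt (real n)"
proof -
  let ?L = "{p \<in> primes_upto n. p\<^sup>2 \<le> n}"
  have "?L \<subseteq> {1..nat \<lfloor>sqrt (real n)\<rfloor>}"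
  proof
    fix p assume p: "p \<in> ?L"
    then have "(real p)\<^sup>2 \<le> real n"
      by (metis (no_types, lifting) mem_Collect_eq of_nat_le_iff of_nat_power)
    then have "real p \<le> sqrt (real n)" by (rule real_le_rsqrt)
    moreover have "0 < p" using p primes_uptoD(4) by auto
    ultimately show "p \<in> {1..nat \<lfloor>sqrt (real n)\<rfloor>}"
      by (auto simp: le_nat_floor)
  qed
  then have "card ?L \<le> nat \<lfloor>sqrt (real n)\<rfloor>"
    using card_mono[of "{1..nat \<lfloor>sqrt (real n)\<rfloor>}" ?L] by simp
  then have "real (card ?L) \<le> real (nat \<lfloor>sqrt (real n)\<rfloor>)" by (rule of_nat_mono)
  also have "\<dots> \<le> sqrt (real n)" by (rule of_nat_floor) simp
  finally show ?thesis .
qed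

text \<open>
  Primes above \<open>sqrt n\<close> satisfy \<open>ln n \<le> 2 ln p\<close>, so their number is controlled by the previous bound; the
  primes up to \<open>sqrt n\<close> are too few to matter.
\<close>

lemma chebyshev_upper: "real (card (primes_upto n)) * ln (real n) \<le> 8 * real n"
proof (cases "n = 0")
  case False
  define L where "L = {p \<in> primes_upto n. p\<^sup>2 \<le> n}"
  define U where "U = {p \<in> primes_upto n. n < p\<^sup>2}"
  have card: "card (primes_upto n) = card L + card U"
    unfolding L_def U_def by (subst card_Un_disjoint[symmetric]) (auto intro!: arg_cong[where f = card])
  have lnn: "0 \<le> ln (real n)" using False by simp
  have "real (card L) \<le> sqrt (real n)"
    unfolding L_def by (rule card_primes_upto_sqrt_le)
  then have "real (card L) * ln (real n) \<le> sqrt (real n) * ln (real n)"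
    by (intro mult_right_mono lnn)
  also have "\<dots> \<le> sqrt (real n) * (2 * sqrt (real n))"
  proof (rule mult_left_mono)
    have "ln (real n) = 2 * ln (sqrt (real n))" using False by (simp add: ln_sqrt)
    also have "\<dots> \<le> 2 * sqrt (real n)" using ln_bound[of "sqrt (real n)"] False by simp
    finally show "ln (real n) \<le> 2 * sqrt (real n)" .
  qed simp
  also have "\<dots> = 2 * real n" by simp
  finally have 1: "real (card L) * ln (real n) \<le> 2 * real n" .
  have "real (card U) * ln (real n) = (\<Sum>p\<in>U. ln (real n))" by simp
  also have "\<dots> \<le> (\<Sum>p\<in>U. 2 * ln (real p))"
  proof (rule sum_mono)
    fix p assume p: "p \<in> U"
    then have "0 < p" using primes_uptoD(4) by (auto simp: U_def)
    have "real n \<le> (real p)\<^sup>2"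
      using p unfolding U_def by (metis (no_types, lifting) mem_Collect_eq of_nat_le_iff of_nat_power less_imp_le)
    then have "ln (real n) \<le> ln ((real p)\<^sup>2)" using False \<open>0 < p\<close> by simp
    then show "ln (real n) \<le> 2 * ln (real p)" using \<open>0 < p\<close> by (simp add: ln_realpow)
  qed
  also have "\<dots> = 2 * (\<Sum>p\<in>U. ln (real p))" by (simp add: sum_distrib_left)
  also have "(\<Sum>p\<in>U. ln (real p)) \<le> (\<Sum>p\<in>primes_upto n. ln (real p))"
    by (rule sum_mono2) (auto simp: U_def dest: primes_uptoD)
  also have "\<dots> \<le> 3 * real n" by (rule sum_ln_primes_le)
  finally have "real (card U) * ln (real n) \<le> 6 * real n" by simp
  with 1 show ?thesis by (simp add: card algebra_simps)
qed simp

lemma multiplicity_eq_sum_of_bool: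
  assumes "prime p" "0 < m" "m \<le> M"
  shows "multiplicity p m = (\<Sum>i=1..M. of_bool (p ^ i dvd m))"
proof -
  have le: "multiplicity p m \<le> M"
  proof -
    have "multiplicity p m < 2 ^ multiplicity p m" by (rule less_exp)
    also have "\<dots> \<le> p ^ multiplicity p m"
      using assms prime_ge_2_nat by (intro power_mono) auto
    also have "\<dots> \<le> m"
      using assms by (intro dvd_imp_le multiplicity_dvd) auto
    finally show ?thesis using assms by simp
  qed
  have "p ^ i dvd m \<longleftrightarrow> i \<le> multiplicity p m" for i
    using assms by (subst power_dvd_iff_le_multiplicity) (auto dest: not_prime_unit)
  then have "(\<Sum>i=1..M. of_bool (p ^ i dvd m) :: nat) = card {i\<in>{1..M}. i \<le> multiplicity p m}"
    by (simp add: sum_of_bool_eq Int_def)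
  also have "{i\<in>{1..M}. i \<le> multiplicity p m} = {1..multiplicity p m}"
    using le by auto
  finally show ?thesis by simp
qed

text \<open>
  Legendre's formula. The summation range may be any \<open>{1..M}\<close> with \<open>n \<le> M\<close>, since the further terms
  vanish; this lets several factorials share one range below.
\<close>

lemma multiplicity_fact:
  assumes "prime p" "n \<le> M"
  shows "multiplicity p (fact n :: nat) = (\<Sum>i=1..M. n div p ^ i)"
  using assms(2)
proof (induction n)
  case (Suc n)
  have "multiplicity p (fact (Suc n) :: nat) = multiplicity p (Suc n) + multiplicity p (fact n :: nat)"
    using assms(1) by (subst fact_Suc, subst prime_elem_multiplicity_mult_distrib) auto
  also have "\<dots> = (\<Sum>i=1..M. of_bool (p ^ i dvd Suc n) + n div p ^ i)"
    using Suc multiplicity_eq_sum_of_bool[OF assms(1), of "Suc n" M] by (simp add: sum.distrib)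
  also have "\<dots> = (\<Sum>i=1..M. Suc n div p ^ i)"
    by (intro sum.cong) (auto simp: div_Suc dvd_eq_mod_eq_0)
  finally show ?case .
qed simp

text \<open>
  By Legendre's formula the exponent of \<open>p\<close> is the sum over \<open>i\<close> of
  \<open>2 n div p ^ i - 2 (n div p ^ i)\<close>. Each term is at most \<open>1\<close> and vanishes once \<open>p ^ i > 2 n\<close>; if
  \<open>p ^ v\<close> exceeded \<open>2 n\<close> for the exponent \<open>v\<close> itself, only the \<open>v - 1\<close> terms with \<open>i < v\<close> would remain.
\<close>

lemma prime_power_central_binomial_le:
  assumes p: "prime p" and n: "0 < n"
  shows "p ^ multiplicity p ((2 * n) choose n) \<le> 2 * n"
proof (rule ccontr)
  define v where "v = multiplicity p ((2 * n) choose n)"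
  assume "\<not> p ^ multiplicity p ((2 * n) choose n) \<le> 2 * n"
  then have big: "2 * n < p ^ v" by (simp add: v_def)
  then have "v \<noteq> 0" using n by (intro notI) simp
  have "fact n * fact (2 * n - n) * ((2 * n) choose n) = (fact (2 * n) :: nat)"
    by (rule binomial_fact_lemma) simp
  then have "multiplicity p (fact (2 * n) :: nat)
      = multiplicity p (fact n * fact n * ((2 * n) choose n) :: nat)"
    by simp
  also have "\<dots> = 2 * multiplicity p (fact n :: nat) + v"
    using p by (simp add: prime_elem_multiplicity_mult_distrib v_def)
  finally have "(\<Sum>i=1..2*n. 2 * n div p ^ i) = 2 * (\<Sum>i=1..2*n. n div p ^ i) + v"
    using p by (simp add: multiplicity_fact[of p _ "2*n"])
  moreover have "(\<Sum>i=1..2*n. 2 * n div p ^ i)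
      \<le> (\<Sum>i=1..2*n. 2 * (n div p ^ i) + of_bool (i < v))"
  proof (rule sum_mono)
    fix i
    show "2 * n div p ^ i \<le> 2 * (n div p ^ i) + of_bool (i < v)"
    proof (cases "i < v")
      case True
      have "0 < p ^ i" using p prime_gt_0_nat by simp
      have "n < p ^ i * (n div p ^ i) + p ^ i"
        using \<open>0 < p ^ i\<close> by (metis add_strict_left_mono mod_less_divisor mult_div_mod_eq)
      then have "2 * n < (2 * (n div p ^ i) + 2) * p ^ i" by (simp add: algebra_simps)
      then have "2 * n div p ^ i < 2 * (n div p ^ i) + 2"
        by (rule less_mult_imp_div_less)
      then show ?thesis using True by simp
    next
      case False
      then have "p ^ v \<le> p ^ i"
        using p prime_gt_0_nat[OF p] by (intro power_increasing) auto
      then show ?thesis using big by simp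
    qed
  qed
  moreover have "(\<Sum>i=1..2*n. of_bool (i < v)) < v"
  proof -
    have "(\<Sum>i=1..2*n. of_bool (i < v)) = card ({1..2*n} \<inter> {i. i < v})"
      by (simp add: sum_of_bool_eq)
    also have "\<dots> \<le> card {1..<v}" by (intro card_mono) auto
    finally show ?thesis using \<open>v \<noteq> 0\<close> by simp
  qed
  ultimately show False
    by (simp add: sum.distrib sum_distrib_left)
qed

lemma central_binomial_le: 
  assumes "0 < n"
  shows "(2 * n) choose n \<le> (2 * n) ^ card (primes_upto (2 * n))"
proof -
  let ?b = "(2 * n) choose n"
  have "?b > 0" by simp
  have sub: "prime_factors ?b \<subseteq> primes_upto (2 * n)"
  proof
    fix p assume p: "p \<in> prime_factors ?b"
    then have "prime p" "p dvd ?b" by auto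
    then have "1 \<le> multiplicity p ?b" using \<open>?b > 0\<close>
      by (simp add: prime_multiplicity_gt_zero_iff Suc_leI)
    then have "p ^ 1 \<le> p ^ multiplicity p ?b"
      using \<open>prime p\<close> prime_gt_0_nat by (intro power_increasing) (auto simp: Suc_le_eq)
    also have "\<dots> \<le> 2 * n" by (rule prime_power_central_binomial_le) fact+
    finally show "p \<in> primes_upto (2 * n)" using \<open>prime p\<close> by (simp add: primes_upto_def)
  qed
  have "?b = (\<Prod>p\<in>prime_factors ?b. p ^ multiplicity p ?b)"
    using \<open>?b > 0\<close> by (rule prime_factorization_nat)
  also have "\<dots> \<le> (\<Prod>p\<in>prime_factors ?b. 2 * n)"
    by (intro prod_mono) (auto intro!: prime_power_central_binomial_le assms)
  also have "\<dots> = (2 * n) ^ card (prime_factors ?b)" by simp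
  also have "\<dots> \<le> (2 * n) ^ card (primes_upto (2 * n))"
    using assms sub by (intro power_increasing card_mono) auto
  finally show ?thesis .
qed

text \<open>
  Compare \<open>4 ^ m / (2 m)\<close>, a lower bound for the central binomial coefficient with \<open>m = n div 2\<close>, with the
  upper bound \<open>(2 m)\<close> to the number of primes up to \<open>2 m\<close>.
\<close>

lemma card_primes_upto_times_ln_ge:
  assumes "2 \<le> n"
  shows "(real n - 1) * ln 2 - ln (real n) \<le> real (card (primes_upto n)) * ln (real n)"
proof -
  define m where "m = n div 2"
  have m: "0 < m" "2 * m \<le> n" "n \<le> 2 * m + 1" using assms by (auto simp: m_def)
  have "4 ^ m / (2 * real m) \<le> real ((2 * m) choose m)"
    by (rule central_binomial_lower_bound) fact
  also have "\<dots> \<le> real ((2 * m) ^ card (primes_upto (2 * m)))"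
    using central_binomial_le[OF m(1)] by (simp only: of_nat_le_iff)
  finally have "4 ^ m / (2 * real m) \<le> (2 * real m) ^ card (primes_upto (2 * m))" by simp
  then have "ln (4 ^ m / (2 * real m)) \<le> ln ((2 * real m) ^ card (primes_upto (2 * m)))"
    using m by (subst ln_le_cancel_iff) auto
  also have "\<dots> = real (card (primes_upto (2 * m))) * ln (2 * real m)"
    using m by (subst ln_realpow) auto
  also have "\<dots> \<le> real (card (primes_upto n)) * ln (real n)"
    using m by (intro mult_mono of_nat_mono card_mono primes_upto_mono) auto
  finally have "ln (4 ^ m / (2 * real m)) \<le> \<dots>" .
  moreover have "ln (4 ^ m / (2 * real m)) = real m * ln 4 - ln (2 * real m)"
    using m by (subst ln_div) (auto simp: ln_realpow)
  moreover have "ln (4::real) = 2 * ln 2"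
    using ln_realpow[of 2 2] by simp
  moreover have "ln (2 * real m) \<le> ln (real n)" using m by simp
  moreover have "(real n - 1) * ln 2 \<le> (2 * real m) * ln 2"
    using m by (intro mult_right_mono) auto
  ultimately show ?thesis by (simp add: algebra_simps)
qed

lemma chebyshev_lower:
  "\<forall>\<^sub>F n in sequentially. real n / 2 \<le> real (card (primes_upto n)) * ln (real n)"
proof -
  have "(\<lambda>n. ln (real n) / real n) \<longlonglongrightarrow> 0"
    using filterlim_compose[OF ln_x_over_x_tendsto_0 filterlim_real_sequentially] .
  then have "\<forall>\<^sub>F n in sequentially. ln (real n) / real n < 1 / 20"
    by (rule order_tendstoD) simp
  then show ?thesis
    using eventually_ge_at_top[of 20]
  proof eventually_elim
    case (elim n)
    then have "ln (real n) < real n / 20" by (simp add: field_simps)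
    moreover have "(real n - 1) * (2 / 3) \<le> (real n - 1) * ln 2"
      using elim ln2_ge_two_thirds by (intro mult_left_mono) auto
    ultimately show ?case
      using card_primes_upto_times_ln_ge[of n] elim by simp
  qed
qed

section \<open>Averages over primes under the Sato--Tate law\<close>

lemma ln_le_linear:
  fixes \<epsilon> t :: real
  assumes "0 < \<epsilon>" "0 < t"
  shows "ln t \<le> \<epsilon> * t + \<bar>ln \<epsilon>\<bar>"
proof -
  have "ln (\<epsilon> * t) \<le> \<epsilon> * t - 1"
    using assms by (intro ln_le_minus_one) simp
  then show ?thesis
    using assms by (simp add: ln_mult)
qed

text \<open>
  Bounds valid for large arguments become uniform at the price of an additive constant. The uniform form
  is needed because these bounds are applied at \<open>N div m\<close> for all \<open>m \<le> N\<close> at once.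
\<close>

lemma eventually_le_imp_le_add_const:
  fixes f g :: "nat \<Rightarrow> real"
  assumes "\<forall>\<^sub>F k in sequentially. f k \<le> g k"
  shows "\<exists>C\<ge>0. \<forall>k. f k \<le> g k + C"
proof -
  obtain K where K: "\<And>k. K \<le> k \<Longrightarrow> f k \<le> g k"
    using assms by (auto simp: eventually_sequentially)
  define C where "C = (\<Sum>k<K. \<bar>f k - g k\<bar>)"
  have "C \<ge> 0" unfolding C_def by (rule sum_nonneg) simp
  moreover have "f k \<le> g k + C" for k
  proof (cases "k < K")
    case True
    then have "\<bar>f k - g k\<bar> \<le> C"
      unfolding C_def by (intro member_le_sum) auto
    then show ?thesis by linarith
  qed (use K[of k] \<open>C \<ge> 0\<close> in simp)
  ultimately show ?thesis by blast
qed

lemma integral_sin_squared: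
  fixes \<alpha> :: real
  assumes "0 \<le> \<alpha>"
  shows "integral {0..\<alpha>} (\<lambda>\<theta>. (sin \<theta>)\<^sup>2) = (\<alpha> - sin \<alpha> * cos \<alpha>) / 2"
proof -
  have "((\<lambda>\<theta>. (sin \<theta>)\<^sup>2) has_integral
      ((\<alpha> - sin \<alpha> * cos \<alpha>) / 2 - (0 - sin 0 * cos 0) / 2)) {0..\<alpha>}"
  proof (rule fundamental_theorem_of_calculus)
    fix x :: real
    have "((\<lambda>x. (x - sin x * cos x) / 2) has_real_derivative
        (1 - (cos x * cos x + sin x * - sin x)) / 2) (at x within {0..\<alpha>})"
      by (auto intro!: derivative_eq_intros)
    moreover have "(1 - (cos x * cos x + sin x * - sin x)) / 2 = (sin x)\<^sup>2"
      using sin_cos_squared_add[of x] by (simp add: power2_eq_square algebra_simps)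
    ultimately show "((\<lambda>x. (x - sin x * cos x) / 2) has_vector_derivative (sin x)\<^sup>2) (at x within {0..\<alpha>})"
      by (simp add: has_real_derivative_iff_has_vector_derivative)
  qed (use assms in simp)
  then show ?thesis by (auto dest: integral_unique)
qed

text \<open>
  The limiting proportion of primes with \<open>a p \<ge> 2 c\<close>, that is, the Sato--Tate measure of \<open>{0..arccos c}\<close>
  in closed form.
\<close>

definition ST_tail :: "real \<Rightarrow> real" where
  "ST_tail c = (arccos c - sin (arccos c) * c) / pi"

text \<open>
  The symmetry of the Sato--Tate law under \<open>\<theta> \<mapsto> \<pi> - \<theta>\<close>, which is why \<open>a\<close> has mean value zero on the
  primes.
\<close>

lemma ST_tail_minus:
  assumes "c \<in> {-1..1}"
  shows "ST_tail (- c) = 1 - ST_tail c"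
  using assms by (simp add: ST_tail_def arccos_minus field_simps)

lemma ST_tail_1: "ST_tail 1 = 0"
  by (simp add: ST_tail_def)

lemma ST_tail_half_pos: "0 < ST_tail (1 / 2)"
proof -
  have "sin (pi / 3) * (1 / 2) < pi / 3"
    using sin_le_one[of "pi / 3"] pi_gt3 by linarith
  then show ?thesis by (simp add: ST_tail_def)
qed

text \<open>
  Pairing the nodes \<open>i\<close> and \<open>M - i\<close>, which are negatives of each other, evaluates the sum by symmetry alone.
\<close>

lemma sum_ST_tail_equidistant:
  assumes "0 < M"
  shows "(\<Sum>i<M. ST_tail (1 - 2 * real i / real M)) = (real M - 1) / 2"
proof -
  define h where "h i = ST_tail (1 - 2 * real i / real M)" for i
  have rev: "h (M - i) = 1 - h i" if "i \<le> M" for i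
  proof -
    have "1 - 2 * real (M - i) / real M = - (1 - 2 * real i / real M)"
      using that assms by (simp add: of_nat_diff field_simps)
    moreover have "1 - 2 * real i / real M \<in> {-1..1}"
      using that assms by (simp add: field_simps)
    ultimately show ?thesis unfolding h_def using ST_tail_minus by metis
  qed
  have "(\<Sum>i<Suc M. h i) = (\<Sum>i<Suc M. h (Suc M - Suc i))"
    by (rule sum.nat_diff_reindex[symmetric])
  also have "\<dots> = (\<Sum>i<Suc M. 1 - h i)"
    by (rule sum.cong) (auto simp: rev)
  also have "\<dots> = real (Suc M) - (\<Sum>i<Suc M. h i)"
    by (simp only: sum_subtractf) simp
  finally have "2 * (\<Sum>i<Suc M. h i) = real M + 1" by simp
  moreover have "h M = 1" using rev[of 0] by (simp add: h_def ST_tail_1)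
  ultimately have "(\<Sum>i<M. h i) = (real M - 1) / 2" by simp
  then show ?thesis by (simp add: h_def)
qed

lemma sato_tate_bounded:
  assumes "sato_tate_distributed a" "prime p"
  shows "\<bar>a p\<bar> \<le> 2"
proof -
  have "a p \<in> {-2..2}" using assms unfolding sato_tate_distributed_def by blast
  then show ?thesis by auto
qed

lemma sato_tate_tail_density:
  assumes st: "sato_tate_distributed a" and c: "-1 < c" "c \<le> 1"
  shows "(\<lambda>n. real (card {p \<in> primes_upto n. 2 * c \<le> a p}) / real (card (primes_upto n)))
           \<longlonglongrightarrow> ST_tail c"
proof -
  have \<alpha>: "arccos c \<in> {0..<pi}"
    using c arccos_less_arccos[of "-1" c] arccos_lbound[of c] by auto
  then have "((\<lambda>x :: real. real (card {p. prime p \<and> real p \<le> x \<and> ST_angle a p \<in> {0..arccos c}})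
        / real (prime_pi x)) \<longlongrightarrow> 2 / pi * integral {0..arccos c} (\<lambda>\<theta>. (sin \<theta>)\<^sup>2)) at_top"
    using st unfolding sato_tate_distributed_def by blast
  from filterlim_compose[OF this filterlim_real_sequentially]
  have "(\<lambda>n. real (card {p. prime p \<and> real p \<le> real n \<and> ST_angle a p \<in> {0..arccos c}})
        / real (card (primes_upto n))) \<longlonglongrightarrow> 2 / pi * integral {0..arccos c} (\<lambda>\<theta>. (sin \<theta>)\<^sup>2)"
    by (simp only: prime_pi_of_nat)
  moreover have "2 / pi * integral {0..arccos c} (\<lambda>\<theta>. (sin \<theta>)\<^sup>2) = ST_tail c"
    using \<alpha> c by (subst integral_sin_squared) (auto simp: ST_tail_def field_simps)
  moreover have "{p. prime p \<and> real p \<le> real n \<and> ST_angle a p \<in> {0..arccos c}}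
      = {p \<in> primes_upto n. 2 * c \<le> a p}" for n
  proof -
    have "ST_angle a p \<in> {0..arccos c} \<longleftrightarrow> 2 * c \<le> a p" if "prime p" for p
    proof -
      have ap: "\<bar>a p / 2\<bar> \<le> 1" using sato_tate_bounded[OF st that] by simp
      then have "arccos (a p / 2) \<le> arccos c \<longleftrightarrow> c \<le> a p / 2"
        using c by (intro arccos_le_mono) auto
      then show ?thesis
        using ap arccos_lbound[of "a p / 2"] by (auto simp: ST_angle_def abs_le_iff)
    qed
    then show ?thesis by (auto simp: primes_upto_def)
  qed
  ultimately show ?thesis by simp
qed

text \<open>
  On \<open>[-1, 1]\<close> the identity is approximated by a step function with \<open>M\<close> jumps of height \<open>2 / M\<close>. Averaged over
  primes, the step function turns into a combination of the counts whose limits the Sato--Tate law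
  supplies. Nodes equally spaced in \<open>u = cos \<theta>\<close> rather than in \<open>\<theta>\<close> make all jumps equal.
\<close>

lemma step_function_approximation:
  fixes u :: real
  assumes "\<bar>u\<bar> \<le> 1" "0 < M"
  shows "\<bar>u - (-1 + 2 / real M * real (card {i \<in> {..<M}. 1 - 2 * real i / real M \<le> u}))\<bar> \<le> 2 / real M"
proof -
  define x where "x = real M * (1 - u) / 2"
  have u: "0 \<le> 1 - u" "1 - u \<le> 2" using assms(1) by (auto simp: abs_le_iff)
  have "real M * (1 - u) \<le> real M * 2" using u by (intro mult_left_mono) auto
  then have x: "0 \<le> x" "x \<le> real M"
    using u by (simp_all add: x_def)
  define k where "k = nat \<lceil>x\<rceil>"
  have k: "x \<le> real k" "real k < x + 1" "k \<le> M"
  proof -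
    have rk: "real k = of_int \<lceil>x\<rceil>" using x(1) by (simp add: k_def)
    show "x \<le> real k" "real k < x + 1"
      unfolding rk using ceiling_correct[of x] by linarith+
    show "k \<le> M" using x(2) by (simp add: k_def nat_le_iff ceiling_le_iff)
  qed
  have iff: "1 - 2 * real i / real M \<le> u \<longleftrightarrow> k \<le> i" for i
  proof -
    have "1 - 2 * real i / real M \<le> u \<longleftrightarrow> 1 - u \<le> 2 * real i / real M" by linarith
    also have "\<dots> \<longleftrightarrow> (1 - u) * real M \<le> 2 * real i"
      using assms(2) by (subst pos_le_divide_eq) auto
    also have "\<dots> \<longleftrightarrow> x \<le> real i" by (simp add: x_def mult.commute)
    also have "\<dots> \<longleftrightarrow> k \<le> i"
      unfolding k_def by (simp add: nat_le_iff ceiling_le_iff)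
    finally show ?thesis .
  qed
  have "{i \<in> {..<M}. k \<le> i} = {k..<M}" by auto
  then have card: "real (card {i \<in> {..<M}. 1 - 2 * real i / real M \<le> u}) = real M - real k"
    unfolding iff using k(3) by (simp add: of_nat_diff)
  have "2 / real M * x = 1 - u" using assms(2) by (simp add: x_def)
  moreover have "2 / real M * (real M - real k) = 2 - 2 / real M * real k"
    using assms(2) by (simp add: right_diff_distrib)
  moreover have "2 / real M * \<bar>real k - x\<bar> \<le> 2 / real M * 1"
    using k by (intro mult_left_mono) auto
  then have "\<bar>2 / real M * real k - 2 / real M * x\<bar> \<le> 2 / real M"
    by (simp only: right_diff_distrib[symmetric] abs_mult) simp
  ultimately show ?thesis unfolding card by linarith
qed

text \<open>
  The mean of the approximating step function tends to
  \<open>-1 + (2 / M) ((M - 1) / 2) = - 1 / M\<close>, and it is within \<open>2 / M\<close> of the mean of \<open>a p / 2\<close>.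
\<close>

lemma sato_tate_mean_zero:
  assumes st: "sato_tate_distributed a" and "0 < \<epsilon>"
  shows "\<forall>\<^sub>F n in sequentially. \<bar>\<Sum>p\<in>primes_upto n. a p\<bar> \<le> \<epsilon> * real (card (primes_upto n))"
proof -
  \<comment> \<open>Two errors of size \<open>2 / M\<close>, doubled on passing from \<open>a p / 2\<close> to \<open>a p\<close>, add up to \<open>8 / M\<close>.\<close>
  obtain M :: nat where M: "8 / \<epsilon> < real M" using reals_Archimedean2 by blast
  moreover have "0 < 8 / \<epsilon>" using \<open>0 < \<epsilon>\<close> by simp
  ultimately have Mpos: "0 < real M" by linarith
  define c where "c i = 1 - 2 * real i / real M" for i
  define cnt where "cnt n i = real (card {p \<in> primes_upto n. 2 * c i \<le> a p})" for n i
  define \<pi> where "\<pi> n = real (card (primes_upto n))" for n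
  have "(\<lambda>n. -1 + 2 / real M * (\<Sum>i<M. cnt n i / \<pi> n)) \<longlonglongrightarrow> -1 + 2 / real M * (\<Sum>i<M. ST_tail (c i))"
    unfolding cnt_def \<pi>_def
    by (intro tendsto_intros sato_tate_tail_density[OF st]) (auto simp: c_def field_simps)
  also have "-1 + 2 / real M * (\<Sum>i<M. ST_tail (c i)) = - 1 / real M"
    unfolding c_def using Mpos by (subst sum_ST_tail_equidistant) (auto simp: field_simps)
  finally have "\<forall>\<^sub>F n in sequentially.
      dist (-1 + 2 / real M * (\<Sum>i<M. cnt n i / \<pi> n)) (- 1 / real M) < 1 / real M"
    using Mpos by (intro tendstoD) auto
  then show ?thesis
  proof eventually_elim
    case (elim n)
    then have lim: "\<bar>-1 + 2 / real M * (\<Sum>i<M. cnt n i / \<pi> n)\<bar> \<le> 2 / real M"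
      unfolding dist_real_def by linarith
    define s where "s p = -1 + 2 / real M * real (card {i \<in> {..<M}. c i \<le> a p / 2})" for p
    have approx: "\<bar>a p / 2 - s p\<bar> \<le> 2 / real M" if "p \<in> primes_upto n" for p
      unfolding s_def c_def
      using sato_tate_bounded[OF st primes_uptoD(1)[OF that]] Mpos
      by (intro step_function_approximation) auto
    have "(\<Sum>p\<in>primes_upto n. real (card {i \<in> {..<M}. c i \<le> a p / 2})) = (\<Sum>i<M. cnt n i)"
    proof -
      have "(\<Sum>p\<in>primes_upto n. real (card {i \<in> {..<M}. c i \<le> a p / 2}))
          = (\<Sum>p\<in>primes_upto n. \<Sum>i<M. of_bool (2 * c i \<le> a p))"
        by (intro sum.cong) (auto simp: sum_of_bool_eq Int_def intro!: arg_cong[where f = card])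
      also have "\<dots> = (\<Sum>i<M. \<Sum>p\<in>primes_upto n. of_bool (2 * c i \<le> a p))"
        by (rule sum.swap)
      also have "\<dots> = (\<Sum>i<M. cnt n i)"
        by (intro sum.cong) (auto simp: cnt_def sum_of_bool_eq Int_def)
      finally show ?thesis .
    qed
    then have sum_s: "(\<Sum>p\<in>primes_upto n. s p) = - \<pi> n + 2 / real M * (\<Sum>i<M. cnt n i)"
      unfolding s_def \<pi>_def sum.distrib sum_distrib_left[symmetric] by simp
    \<comment> \<open>For small \<open>n\<close> there may be no primes, and then the quotients take the default value \<open>0\<close>.\<close>
    have cnt_0: "cnt n i = 0" if "\<pi> n = 0" for i
      using that by (simp add: cnt_def \<pi>_def)
    have "(\<Sum>p\<in>primes_upto n. s p) = \<pi> n * (-1 + 2 / real M * (\<Sum>i<M. cnt n i / \<pi> n))"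
      unfolding sum_s sum_divide_distrib[symmetric]
      by (cases "\<pi> n = 0") (simp_all add: cnt_0 right_diff_distrib)
    then have "\<bar>\<Sum>p\<in>primes_upto n. s p\<bar> \<le> \<pi> n * (2 / real M)"
      using mult_left_mono[OF lim, of "\<pi> n"] by (simp only: abs_mult) (simp add: \<pi>_def)
    moreover have "\<bar>(\<Sum>p\<in>primes_upto n. a p / 2) - (\<Sum>p\<in>primes_upto n. s p)\<bar> \<le> \<pi> n * (2 / real M)"
      unfolding sum_subtractf[symmetric] \<pi>_def
      using sum_norm_bound[of "primes_upto n" "\<lambda>p. a p / 2 - s p" "2 / real M"] approx by simp
    ultimately have "2 * \<bar>\<Sum>p\<in>primes_upto n. a p / 2\<bar> \<le> 4 * (\<pi> n * (2 / real M))"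
      by linarith
    then have "\<bar>\<Sum>p\<in>primes_upto n. a p\<bar> \<le> \<pi> n * (8 / real M)"
      unfolding sum_divide_distrib[symmetric] by (simp add: mult.commute)
    also have "\<dots> \<le> \<pi> n * \<epsilon>"
      using M Mpos \<open>0 < \<epsilon>\<close> by (intro mult_left_mono) (auto simp: \<pi>_def field_simps)
    finally show ?case by (simp add: \<pi>_def mult.commute)
  qed
qed

lemma sum_inverse_sqrt_le: "(\<Sum>n=1..k. 1 / sqrt (real n)) \<le> 2 * sqrt (real k)"
proof (induction k)
  case (Suc k)
  have "1 = (sqrt (real (Suc k)) + sqrt (real k)) * (sqrt (real (Suc k)) - sqrt (real k))"
    by (simp add: algebra_simps)
  also have "\<dots> \<le> (2 * sqrt (real (Suc k))) * (sqrt (real (Suc k)) - sqrt (real k))"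
    by (intro mult_right_mono) auto
  finally have "1 / sqrt (real (Suc k)) \<le> 2 * (sqrt (real (Suc k)) - sqrt (real k))"
    by (simp add: field_simps)
  then show ?case using Suc by simp
qed simp

lemma card_primes_upto_negligible:
  assumes "0 < \<delta>"
  shows "\<forall>\<^sub>F n in sequentially. real (card (primes_upto n)) \<le> \<delta> * real n"
proof -
  have "filterlim (\<lambda>n. ln (real n)) at_top sequentially"
    by (rule filterlim_compose[OF ln_at_top filterlim_real_sequentially])
  then have "\<forall>\<^sub>F n in sequentially. 8 / \<delta> \<le> ln (real n)"
    by (simp add: filterlim_at_top)
  then show ?thesis
  proof eventually_elim
    case (elim n)
    have "real (card (primes_upto n)) * (8 / \<delta>) \<le> real (card (primes_upto n)) * ln (real n)"
      by (intro mult_left_mono elim) simp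
    also have "\<dots> \<le> 8 * real n" by (rule chebyshev_upper)
    finally show ?case using assms by (simp add: field_simps)
  qed
qed

text \<open>
  By \<open>ln t \<le> 2 (\<eta> sqrt t + C)\<close>, the sum splits into a part that is small even when extended to all integers
  and a part that is small because primes have density zero.
\<close>

lemma sum_ln_quotient_primes_negligible:
  assumes "0 < \<epsilon>"
  shows "\<forall>\<^sub>F n in sequentially. (\<Sum>p\<in>primes_upto n. ln (real n / real p)) \<le> \<epsilon> * real n"
proof -
  define \<eta> where "\<eta> = \<epsilon> / 8"
  define K where "K = 2 * \<bar>ln \<eta>\<bar> + 1"
  have "0 < \<eta>" "0 < K" using assms by (auto simp: \<eta>_def K_def)
  have "\<forall>\<^sub>F n in sequentially. real (card (primes_upto n)) \<le> (\<epsilon> / (2 * K)) * real n"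
    using assms \<open>0 < K\<close> by (intro card_primes_upto_negligible) simp
  then show ?thesis
  proof eventually_elim
    case (elim n)
    have "(\<Sum>p\<in>primes_upto n. ln (real n / real p))
        \<le> (\<Sum>p\<in>primes_upto n. 2 * \<eta> * sqrt (real n) * (1 / sqrt (real p)) + K)"
    proof (rule sum_mono)
      fix p assume p: "p \<in> primes_upto n"
      then have pos: "0 < real p" "0 < real n"
        using primes_uptoD(2,4)[OF p] by auto
      then have "ln (real n / real p) = 2 * ln (sqrt (real n / real p))"
        by (subst ln_sqrt) auto
      also have "\<dots> \<le> 2 * (\<eta> * sqrt (real n / real p) + \<bar>ln \<eta>\<bar>)"
        using pos \<open>0 < \<eta>\<close> by (intro mult_left_mono ln_le_linear) auto
      also have "\<dots> \<le> 2 * \<eta> * sqrt (real n) * (1 / sqrt (real p)) + K"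
        by (simp add: K_def real_sqrt_divide)
      finally show "ln (real n / real p) \<le> \<dots>" .
    qed
    also have "\<dots> = 2 * \<eta> * sqrt (real n) * (\<Sum>p\<in>primes_upto n. 1 / sqrt (real p))
        + K * real (card (primes_upto n))"
      by (simp only: sum.distrib sum_distrib_left) simp
    finally have "(\<Sum>p\<in>primes_upto n. ln (real n / real p)) \<le> \<dots>" .
    moreover have "(\<Sum>p\<in>primes_upto n. 1 / sqrt (real p)) \<le> 2 * sqrt (real n)"
    proof -
      have "(\<Sum>p\<in>primes_upto n. 1 / sqrt (real p)) \<le> (\<Sum>m=1..n. 1 / sqrt (real m))"
        by (rule sum_mono2) (auto simp: primes_upto_def prime_ge_Suc_0_nat)
      then show ?thesis using sum_inverse_sqrt_le[of n] by linarith
    qed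
    then have "2 * \<eta> * sqrt (real n) * (\<Sum>p\<in>primes_upto n. 1 / sqrt (real p))
        \<le> 2 * \<eta> * sqrt (real n) * (2 * sqrt (real n))"
      using \<open>0 < \<eta>\<close> by (intro mult_left_mono) auto
    moreover have "2 * \<eta> * sqrt (real n) * (2 * sqrt (real n)) = \<epsilon> / 2 * real n"
      by (simp add: \<eta>_def)
    moreover have "K * real (card (primes_upto n)) \<le> K * ((\<epsilon> / (2 * K)) * real n)"
      using elim \<open>0 < K\<close> by (intro mult_left_mono) auto
    moreover have "K * ((\<epsilon> / (2 * K)) * real n) = \<epsilon> / 2 * real n"
      using \<open>0 < K\<close> by simp
    moreover have "\<epsilon> * real n = \<epsilon> / 2 * real n + \<epsilon> / 2 * real n" by simp
    ultimately show ?case by linarith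
  qed
qed

text \<open>
  Write \<open>ln p = ln n - ln (n / p)\<close>: the first term is handled by the mean value and Chebyshev's upper bound,
  the second by the previous lemma.
\<close>

lemma sato_tate_weighted_mean_zero:
  assumes st: "sato_tate_distributed a" and "0 < \<epsilon>"
  shows "\<exists>C\<ge>0. \<forall>n. \<bar>\<Sum>p\<in>primes_upto n. a p * ln (real p)\<bar> \<le> \<epsilon> * real n + C"
proof (rule eventually_le_imp_le_add_const)
  have "\<forall>\<^sub>F n in sequentially. \<bar>\<Sum>p\<in>primes_upto n. a p\<bar> \<le> \<epsilon> / 16 * real (card (primes_upto n))"
    using \<open>0 < \<epsilon>\<close> by (intro sato_tate_mean_zero[OF st]) simp
  moreover have "\<forall>\<^sub>F n in sequentially. (\<Sum>p\<in>primes_upto n. ln (real n / real p)) \<le> \<epsilon> / 4 * real n"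
    using \<open>0 < \<epsilon>\<close> by (intro sum_ln_quotient_primes_negligible) simp
  ultimately show "\<forall>\<^sub>F n in sequentially. \<bar>\<Sum>p\<in>primes_upto n. a p * ln (real p)\<bar> \<le> \<epsilon> * real n"
    using eventually_gt_at_top[of 0]
  proof eventually_elim
    case (elim n)
    have "(\<Sum>p\<in>primes_upto n. a p * ln (real p))
        = (\<Sum>p\<in>primes_upto n. a p * ln (real n) - a p * ln (real n / real p))"
      using elim by (intro sum.cong) (auto simp: ln_div algebra_simps dest: primes_uptoD)
    also have "\<dots> = (\<Sum>p\<in>primes_upto n. a p) * ln (real n)
        - (\<Sum>p\<in>primes_upto n. a p * ln (real n / real p))"
      by (simp add: sum_subtractf sum_distrib_right)
    finally have split: "(\<Sum>p\<in>primes_upto n. a p * ln (real p)) = \<dots>" .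
    have "\<bar>(\<Sum>p\<in>primes_upto n. a p) * ln (real n)\<bar>
        \<le> \<epsilon> / 16 * real (card (primes_upto n)) * ln (real n)"
      unfolding abs_mult using elim by (intro mult_mono) auto
    also have "\<dots> \<le> \<epsilon> / 16 * (8 * real n)"
      using mult_left_mono[OF chebyshev_upper[of n], of "\<epsilon> / 16"] \<open>0 < \<epsilon>\<close>
      by (simp add: mult.assoc)
    finally have 1: "\<bar>(\<Sum>p\<in>primes_upto n. a p) * ln (real n)\<bar> \<le> \<epsilon> / 2 * real n" by simp
    have "\<bar>\<Sum>p\<in>primes_upto n. a p * ln (real n / real p)\<bar>
        \<le> (\<Sum>p\<in>primes_upto n. 2 * ln (real n / real p))"
    proof (rule sum_abs[THEN order_trans], rule sum_mono)
      fix p assume p: "p \<in> primes_upto n"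
      then have "0 \<le> ln (real n / real p)"
        using primes_uptoD(2,4)[OF p] by simp
      then show "\<bar>a p * ln (real n / real p)\<bar> \<le> 2 * ln (real n / real p)"
        using sato_tate_bounded[OF st primes_uptoD(1)[OF p]] by (simp add: abs_mult mult_right_mono)
    qed
    also have "\<dots> \<le> \<epsilon> / 2 * real n"
      using elim by (simp flip: sum_distrib_left)
    finally show ?case using 1 unfolding split by linarith
  qed
qed

text \<open>
  The Sato--Tate law gives a positive proportion of primes with \<open>a p \<ge> 1\<close>. All but at most \<open>sqrt n\<close> of them exceed
  \<open>sqrt n\<close> and so have weight \<open>ln p \<ge> (ln n) / 2\<close>; Chebyshev's lower bound then gives linear growth.
\<close>

lemma sato_tate_abs_lower:
  assumes st: "sato_tate_distributed a"
  shows "\<exists>c>0. \<exists>C\<ge>0. \<forall>n. c * real n \<le> (\<Sum>p\<in>primes_upto n. \<bar>a p\<bar> * ln (real p)) + C"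
proof -
  define h where "h = ST_tail (1 / 2) / 2"
  have h: "0 < h" "h < ST_tail (1 / 2)" using ST_tail_half_pos by (auto simp: h_def)
  have "\<forall>\<^sub>F n in sequentially.
      h < real (card {p \<in> primes_upto n. 2 * (1 / 2) \<le> a p}) / real (card (primes_upto n))"
    by (rule order_tendstoD(1)[OF sato_tate_tail_density[OF st] h(2)]) auto
  moreover have "\<forall>\<^sub>F n in sequentially. ln (real n) / sqrt (real n) < h / 4"
  proof -
    have "(\<lambda>n. ln (real n) / real n powr (1 / 2)) \<longlonglongrightarrow> 0"
      by (rule lim_ln_over_power) simp
    then have "\<forall>\<^sub>F n in sequentially. ln (real n) / real n powr (1 / 2) < h / 4"
      using h by (intro order_tendstoD(2)) auto
    then show ?thesis by (simp add: powr_half_sqrt)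
  qed
  ultimately have "\<forall>\<^sub>F n in sequentially. h / 8 * real n \<le> (\<Sum>p\<in>primes_upto n. \<bar>a p\<bar> * ln (real p))"
    using chebyshev_lower eventually_gt_at_top[of 1]
  proof eventually_elim
    case (elim n)
    define \<pi> where "\<pi> = real (card (primes_upto n))"
    define S where "S = {p \<in> primes_upto n. p\<^sup>2 \<le> n}"
    define B where "B = {p \<in> primes_upto n. 1 \<le> a p}"
    have fin: "finite S" "finite B" by (auto simp: S_def B_def)
    have lnn: "0 < ln (real n)" using elim by simp
    have "0 < \<pi>"
    proof (rule ccontr)
      assume "\<not> 0 < \<pi>"
      then show False using elim(3,4) by (simp add: \<pi>_def)
    qed
    then have cB: "h * \<pi> \<le> real (card B)"
      using elim(1) by (simp add: B_def \<pi>_def field_simps)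
    have "sqrt (real n) * ln (real n) \<le> sqrt (real n) * (h / 4 * sqrt (real n))"
      using elim by (intro mult_left_mono) (auto simp: field_simps)
    then have "sqrt (real n) * ln (real n) \<le> h / 4 * real n" by (simp add: algebra_simps)
    moreover have "real (card S) * ln (real n) \<le> sqrt (real n) * ln (real n)"
      unfolding S_def using card_primes_upto_sqrt_le[of n] lnn by (intro mult_right_mono) auto
    ultimately have cS: "real (card S) * ln (real n) \<le> h / 4 * real n" by linarith
    have "real (card B) - real (card S) \<le> real (card (B - S))"
      using diff_card_le_card_Diff[OF fin(1), of B] by linarith
    then have "(real (card B) - real (card S)) * (ln (real n) / 2)
        \<le> real (card (B - S)) * (ln (real n) / 2)"
      using lnn by (intro mult_right_mono) auto
    also have "\<dots> = (\<Sum>p\<in>B - S. ln (real n) / 2)" by simp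
    also have "\<dots> \<le> (\<Sum>p\<in>B - S. \<bar>a p\<bar> * ln (real p))"
    proof (rule sum_mono)
      fix p assume p: "p \<in> B - S"
      then have mem: "p \<in> primes_upto n" and "n < p\<^sup>2" and "1 \<le> a p" by (auto simp: B_def S_def)
      then have "real n \<le> (real p)\<^sup>2" by (metis less_imp_le of_nat_le_iff of_nat_power)
      then have "ln (real n) \<le> ln ((real p)\<^sup>2)"
        using elim primes_uptoD(4)[OF mem] by simp
      then have "ln (real n) / 2 \<le> 1 * ln (real p)"
        using primes_uptoD(4)[OF mem] by (simp add: ln_realpow)
      also have "\<dots> \<le> \<bar>a p\<bar> * ln (real p)"
        using primes_uptoD(5)[OF mem] \<open>1 \<le> a p\<close> by (intro mult_right_mono) auto
      finally show "ln (real n) / 2 \<le> \<bar>a p\<bar> * ln (real p)" .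
    qed
    also have "\<dots> \<le> (\<Sum>p\<in>primes_upto n. \<bar>a p\<bar> * ln (real p))"
      by (rule sum_mono2) (auto simp: B_def dest: primes_uptoD)
    finally have "(real (card B) - real (card S)) * (ln (real n) / 2)
      \<le> (\<Sum>p\<in>primes_upto n. \<bar>a p\<bar> * ln (real p))" .
    moreover have "h * (real n / 2) \<le> h * (\<pi> * ln (real n))"
      using elim h by (intro mult_left_mono) (auto simp: \<pi>_def)
    moreover have "h * \<pi> * ln (real n) \<le> real (card B) * ln (real n)"
      using cB lnn by (intro mult_right_mono) auto
    ultimately show ?case using cS by (simp add: algebra_simps)
  qed
  then obtain C where "C \<ge> 0" "\<And>n. h / 8 * real n \<le> (\<Sum>p\<in>primes_upto n. \<bar>a p\<bar> * ln (real p)) + C"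
    using eventually_le_imp_le_add_const by meson
  then show ?thesis using h by (intro exI[of _ "h / 8"]) auto
qed

section \<open>Quantities negligible against logarithmic averages\<close>

definition abs_sum :: "(nat \<Rightarrow> real) \<Rightarrow> nat \<Rightarrow> real" where
  "abs_sum a N = (\<Sum>n=1..N. \<bar>a n\<bar>)"

definition abs_log_sum :: "(nat \<Rightarrow> real) \<Rightarrow> nat \<Rightarrow> real" where
  "abs_log_sum a N = (\<Sum>n=1..N. \<bar>a n\<bar> / real n)"

text \<open>
  \<open>N L(N)\<close> turns out to be of order at most \<open>A(N) ln N\<close>, so negligible quantities are \<open>o(A(N) ln N)\<close>. The
  definition is phrased in terms of both sums so that negligibility can be shown, and used, before that comparison.
\<close>

definition negligible_for :: "(nat \<Rightarrow> real) \<Rightarrow> (nat \<Rightarrow> real) \<Rightarrow> bool" where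
  "negligible_for a g \<longleftrightarrow>
     (\<forall>\<epsilon>>0. \<exists>C\<ge>0. \<forall>N. \<bar>g N\<bar> \<le> \<epsilon> * (real N * abs_log_sum a N) + C * abs_sum a N)"

lemma abs_sum_nonneg: "0 \<le> abs_sum a N"
  by (simp add: abs_sum_def sum_nonneg)

lemma abs_log_sum_nonneg: "0 \<le> abs_log_sum a N"
  by (simp add: abs_log_sum_def sum_nonneg)

lemma abs_sum_mono: "M \<le> N \<Longrightarrow> abs_sum a M \<le> abs_sum a N"
  unfolding abs_sum_def by (rule sum_mono2) auto

text \<open>
  Every \<open>n \<le> N / q\<close> has \<open>1 \<le> (N / q) / n\<close>.
\<close>

lemma abs_sum_div_le:
  assumes "0 < q"
  shows "abs_sum a (N div q) \<le> real N / real q * abs_log_sum a N"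
proof -
  have "abs_sum a (N div q) \<le> (\<Sum>n=1..N div q. real N / real q * (\<bar>a n\<bar> / real n))"
    unfolding abs_sum_def
  proof (rule sum_mono)
    fix n assume n: "n \<in> {1..N div q}"
    then have "n * q \<le> N" using assms by (simp add: less_eq_div_iff_mult_less_eq)
    then have "real n * real q \<le> real N" by (metis of_nat_le_iff of_nat_mult)
    then have "1 \<le> real N / (real q * real n)"
      using n assms by (simp add: le_divide_eq mult.commute)
    then have "\<bar>a n\<bar> * 1 \<le> \<bar>a n\<bar> * (real N / (real q * real n))"
      by (intro mult_left_mono) auto
    then show "\<bar>a n\<bar> \<le> real N / real q * (\<bar>a n\<bar> / real n)" by (simp add: mult.commute)
  qed
  also have "\<dots> \<le> (\<Sum>n=1..N. real N / real q * (\<bar>a n\<bar> / real n))"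
    by (rule sum_mono2) (use div_le_dividend[of N q] in auto)
  also have "\<dots> = real N / real q * abs_log_sum a N"
    unfolding abs_log_sum_def by (rule sum_distrib_left[symmetric])
  finally show ?thesis .
qed

lemma negligible_for_add:
  assumes "negligible_for a f" "negligible_for a g"
  shows "negligible_for a (\<lambda>N. f N + g N)"
  unfolding negligible_for_def
proof (intro allI impI)
  fix \<epsilon> :: real assume "0 < \<epsilon>"
  then have "0 < \<epsilon> / 2" by simp
  obtain C D where
    C: "C \<ge> 0" "\<And>N. \<bar>f N\<bar> \<le> \<epsilon> / 2 * (real N * abs_log_sum a N) + C * abs_sum a N" and
    D: "D \<ge> 0" "\<And>N. \<bar>g N\<bar> \<le> \<epsilon> / 2 * (real N * abs_log_sum a N) + D * abs_sum a N"
    using assms \<open>0 < \<epsilon> / 2\<close> unfolding negligible_for_def by meson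
  show "\<exists>C\<ge>0. \<forall>N. \<bar>f N + g N\<bar> \<le> \<epsilon> * (real N * abs_log_sum a N) + C * abs_sum a N"
  proof (intro exI[of _ "C + D"] conjI allI)
    fix N
    have "\<bar>f N + g N\<bar> \<le> \<bar>f N\<bar> + \<bar>g N\<bar>" by (rule abs_triangle_ineq)
    also have "\<dots> \<le> \<epsilon> * (real N * abs_log_sum a N) + (C + D) * abs_sum a N"
      using C(2)[of N] D(2)[of N] unfolding distrib_right by linarith
    finally show "\<bar>f N + g N\<bar> \<le> \<dots>" .
  qed (use C D in simp)
qed

lemma negligible_for_mono:
  assumes "negligible_for a g" "\<And>N. \<bar>f N\<bar> \<le> \<bar>g N\<bar>"
  shows "negligible_for a f"
  using assms unfolding negligible_for_def by (meson order_trans)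

lemma negligible_for_convolution:
  assumes "\<And>\<epsilon>. 0 < \<epsilon> \<Longrightarrow> \<exists>C\<ge>0. \<forall>N. \<forall>m\<in>{1..N}. \<bar>g N m\<bar> \<le> \<epsilon> * (real N / real m) + C"
  shows "negligible_for a (\<lambda>N. \<Sum>m=1..N. a m * g N m)"
  unfolding negligible_for_def
proof (intro allI impI)
  fix \<epsilon> :: real assume "0 < \<epsilon>"
  from assms[OF this] obtain C where C: "C \<ge> 0"
    "\<And>N m. m \<in> {1..N} \<Longrightarrow> \<bar>g N m\<bar> \<le> \<epsilon> * (real N / real m) + C"
    by blast
  show "\<exists>C\<ge>0. \<forall>N. \<bar>\<Sum>m=1..N. a m * g N m\<bar> \<le> \<epsilon> * (real N * abs_log_sum a N) + C * abs_sum a N"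
  proof (intro exI[of _ C] conjI allI)
    fix N
    have "\<bar>\<Sum>m=1..N. a m * g N m\<bar> \<le> (\<Sum>m=1..N. \<bar>a m\<bar> * \<bar>g N m\<bar>)"
      by (rule order_trans[OF sum_abs]) (simp add: abs_mult)
    also have "\<dots> \<le> (\<Sum>m=1..N. \<bar>a m\<bar> * (\<epsilon> * (real N / real m) + C))"
      by (intro sum_mono mult_left_mono C(2)) auto
    also have "\<dots> = (\<Sum>m=1..N. (\<epsilon> * real N) * (\<bar>a m\<bar> / real m) + C * \<bar>a m\<bar>)"
      by (intro sum.cong) (auto simp: distrib_left)
    also have "\<dots> = \<epsilon> * (real N * abs_log_sum a N) + C * abs_sum a N"
      unfolding sum.distrib sum_distrib_left[symmetric] abs_log_sum_def abs_sum_def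
      by (simp only: mult.assoc)
    finally show "\<bar>\<Sum>m=1..N. a m * g N m\<bar> \<le> \<dots>" .
  qed (rule C(1))
qed

lemma bounded_sums_small_tail:
  fixes f :: "'i \<Rightarrow> real"
  assumes bdd: "\<And>F. finite F \<Longrightarrow> F \<subseteq> I \<Longrightarrow> sum f F \<le> B" and "0 < \<epsilon>"
  obtains F where "finite F" "F \<subseteq> I" "\<And>G. finite G \<Longrightarrow> G \<subseteq> I - F \<Longrightarrow> sum f G \<le> \<epsilon>"
proof -
  define S where "S = sum f ` {F. finite F \<and> F \<subseteq> I}"
  have S: "bdd_above S" "S \<noteq> {}"
    unfolding S_def using bdd by (auto intro!: bdd_aboveI[of _ B])
  have "Sup S - \<epsilon> < Sup S" using \<open>0 < \<epsilon>\<close> by simp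
  then obtain s where "s \<in> S" "Sup S - \<epsilon> < s"
    using less_cSup_iff[OF S(2) S(1)] by blast
  then obtain F where F: "finite F" "F \<subseteq> I" "Sup S - \<epsilon> < sum f F"
    unfolding S_def by auto
  show ?thesis
  proof (rule that[OF F(1,2)])
    fix G assume G: "finite G" "G \<subseteq> I - F"
    then have "sum f (F \<union> G) \<in> S" using F unfolding S_def by blast
    then have "sum f (F \<union> G) \<le> Sup S" by (rule cSup_upper[OF _ S(1)])
    moreover have "sum f (F \<union> G) = sum f F + sum f G"
      using F G by (intro sum.union_disjoint) auto
    ultimately show "sum f G \<le> \<epsilon>" using F(3) by linarith
  qed
qed

text \<open>
  Split the index set into a finite part, where \<open>A(N / q) \<le> A(N)\<close>, and a tail of small total weight,
  where \<open>A(N / q) \<le> (N / q) L(N)\<close>.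
\<close>

lemma negligible_for_dilations:
  fixes q :: "'i \<Rightarrow> nat" and w :: "'i \<Rightarrow> real"
  assumes w: "\<And>i. i \<in> I \<Longrightarrow> 0 \<le> w i" and q: "\<And>i. i \<in> I \<Longrightarrow> 0 < q i"
    and bdd: "\<And>F. finite F \<Longrightarrow> F \<subseteq> I \<Longrightarrow> (\<Sum>i\<in>F. w i / real (q i)) \<le> B"
    and Q: "\<And>N. finite (Q N)" "\<And>N. Q N \<subseteq> I"
  shows "negligible_for a (\<lambda>N. \<Sum>i\<in>Q N. w i * abs_sum a (N div q i))"
  unfolding negligible_for_def
proof (intro allI impI)
  fix \<epsilon> :: real assume "0 < \<epsilon>"
  obtain F where F: "finite F" "F \<subseteq> I"
    "\<And>G. finite G \<Longrightarrow> G \<subseteq> I - F \<Longrightarrow> (\<Sum>i\<in>G. w i / real (q i)) \<le> \<epsilon>"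
    using bounded_sums_small_tail[of I "\<lambda>i. w i / real (q i)" B \<epsilon>] bdd \<open>0 < \<epsilon>\<close> by metis
  show "\<exists>C\<ge>0. \<forall>N. \<bar>\<Sum>i\<in>Q N. w i * abs_sum a (N div q i)\<bar>
      \<le> \<epsilon> * (real N * abs_log_sum a N) + C * abs_sum a N"
  proof (intro exI[of _ "sum w F"] conjI allI)
    show "0 \<le> sum w F" using F w by (intro sum_nonneg) auto
    fix N
    let ?t = "\<lambda>i. w i * abs_sum a (N div q i)"
    have t: "0 \<le> ?t i" if "i \<in> I" for i using w[OF that] abs_sum_nonneg by simp
    have "sum ?t (Q N) = sum ?t (Q N \<inter> F) + sum ?t (Q N - F)"
      using Q(1) by (rule sum.Int_Diff)
    also have "sum ?t (Q N \<inter> F) \<le> sum ?t F"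
      using F t by (intro sum_mono2) auto
    also have "sum ?t F \<le> (\<Sum>i\<in>F. w i * abs_sum a N)"
      using F w by (intro sum_mono mult_left_mono abs_sum_mono) auto
    also have "\<dots> = sum w F * abs_sum a N" by (rule sum_distrib_right[symmetric])
    also have "sum ?t (Q N - F) \<le> (\<Sum>i\<in>Q N - F. w i / real (q i) * (real N * abs_log_sum a N))"
    proof (rule sum_mono)
      fix i assume "i \<in> Q N - F"
      then have i: "i \<in> I" using Q by auto
      have "?t i \<le> w i * (real N / real (q i) * abs_log_sum a N)"
        by (intro mult_left_mono abs_sum_div_le q w i)
      then show "?t i \<le> w i / real (q i) * (real N * abs_log_sum a N)" by simp
    qed
    also have "\<dots> = (\<Sum>i\<in>Q N - F. w i / real (q i)) * (real N * abs_log_sum a N)"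
      by (rule sum_distrib_right[symmetric])
    also have "\<dots> \<le> \<epsilon> * (real N * abs_log_sum a N)"
      by (intro mult_right_mono F(3)) (use Q abs_log_sum_nonneg in auto)
    finally have "sum ?t (Q N) \<le> sum w F * abs_sum a N + \<epsilon> * (real N * abs_log_sum a N)"
      by simp
    moreover have "0 \<le> sum ?t (Q N)" using Q t by (intro sum_nonneg) auto
    ultimately show "\<bar>sum ?t (Q N)\<bar> \<le> \<epsilon> * (real N * abs_log_sum a N) + sum w F * abs_sum a N"
      by linarith
  qed
qed

section \<open>The logarithmic identity for multiplicative functions\<close>

text \<open>
  This bounds the contribution of \<open>p ^ k\<close>, per unit of \<open>f m\<close> with \<open>m\<close> prime to \<open>p\<close>, to the error
  in the logarithmic identity: the first summand comes from \<open>ln n\<close>, and the second from the products \<open>f p * f m'\<close> with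
  \<open>p\<close> dividing \<open>m'\<close>, for which \<open>f (p * m')\<close> does not factor.
\<close>

definition prime_power_weight :: "(nat \<Rightarrow> real) \<Rightarrow> nat \<Rightarrow> nat \<Rightarrow> real" where
  "prime_power_weight f p k =
     ln (real p) * (real k * \<bar>f (p ^ k)\<bar> + \<bar>f p\<bar> * \<bar>f (p ^ (k - 1))\<bar>)"

definition higher_prime_powers_upto :: "nat \<Rightarrow> (nat \<times> nat) set" where
  "higher_prime_powers_upto N = {(p, k). prime p \<and> 2 \<le> k \<and> p ^ k \<le> N}"

lemma finite_higher_prime_powers_upto: "finite (higher_prime_powers_upto N)"
proof (rule finite_subset)
  show "higher_prime_powers_upto N \<subseteq> {..N} \<times> {..N}"
  proof
    fix x assume "x \<in> higher_prime_powers_upto N"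
    then obtain p k where x: "x = (p, k)" "prime p" "2 \<le> k" "p ^ k \<le> N"
      by (auto simp: higher_prime_powers_upto_def)
    have "2 \<le> p" using x prime_ge_2_nat by simp
    have "k < 2 ^ k" by (rule less_exp)
    also have "\<dots> \<le> p ^ k" using \<open>2 \<le> p\<close> by (intro power_mono) auto
    finally have "k \<le> N" using x by simp
    moreover have "p ^ 1 \<le> p ^ k" using x \<open>2 \<le> p\<close> by (intro power_increasing) auto
    ultimately show "x \<in> {..N} \<times> {..N}" using x by simp
  qed
qed simp

lemma ln_eq_sum_prime_factors:
  assumes "0 < n"
  shows "ln (real n) = (\<Sum>p\<in>prime_factors n. real (multiplicity p n) * ln (real p))"
proof -
  have pos: "0 < p" if "p \<in> prime_factors n" for p
    by (rule prime_gt_0_nat[OF in_prime_factors_imp_prime[OF that]])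
  have "real n = (\<Prod>p\<in>prime_factors n. real p ^ multiplicity p n)"
    by (subst prime_factorization_nat[OF assms]) simp
  then have "ln (real n) = ln (\<Prod>p\<in>prime_factors n. real p ^ multiplicity p n)"
    by (rule arg_cong)
  also have "\<dots> = (\<Sum>p\<in>prime_factors n. ln (real p ^ multiplicity p n))"
    by (rule ln_prod) (use pos in auto)
  also have "\<dots> = (\<Sum>p\<in>prime_factors n. real (multiplicity p n) * ln (real p))"
    by (intro sum.cong refl ln_realpow)
  finally show ?thesis .
qed

text \<open>
  Collect the pairs \<open>(p, m)\<close> by their product \<open>n = p m\<close>.
\<close>

lemma sum_over_prime_cofactor:
  fixes h :: "nat \<Rightarrow> nat \<Rightarrow> real"
  shows "(\<Sum>m=1..N. \<Sum>p\<in>primes_upto (N div m). h p m)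
       = (\<Sum>n=1..N. \<Sum>p\<in>prime_factors n. h p (n div p))"
proof -
  have "(\<Sum>m=1..N. \<Sum>p\<in>primes_upto (N div m). h p m)
      = (\<Sum>(m, p)\<in>(SIGMA m:{1..N}. primes_upto (N div m)). h p m)"
    by (rule sum.Sigma) auto
  also have "\<dots> = (\<Sum>(n, p)\<in>(SIGMA n:{1..N}. prime_factors n). h p (n div p))"
  proof (rule sum.reindex_bij_witness[where i = "\<lambda>(n, p). (n div p, p)" and j = "\<lambda>(m, p). (m * p, p)"])
    fix x assume "x \<in> (SIGMA m:{1..N}. primes_upto (N div m))"
    then obtain m p where x: "x = (m, p)" "1 \<le> m" "m \<le> N" "prime p" "p \<le> N div m"
      by (auto simp: primes_upto_def)
    then have "0 < p" by (simp add: prime_gt_0_nat)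
    moreover have "m * p \<le> N"
      using x by (simp add: less_eq_div_iff_mult_less_eq mult.commute)
    ultimately show "(case case x of (m, p) \<Rightarrow> (m * p, p) of (n, p) \<Rightarrow> (n div p, p)) = x"
      and "(case x of (m, p) \<Rightarrow> (m * p, p)) \<in> (SIGMA n:{1..N}. prime_factors n)"
      and "(case case x of (m, p) \<Rightarrow> (m * p, p) of (n, p) \<Rightarrow> h p (n div p)) = (case x of (m, p) \<Rightarrow> h p m)"
      using x by (auto simp: prime_factors_dvd)
  next
    fix x assume "x \<in> (SIGMA n:{1..N}. prime_factors n)"
    then obtain n p where x: "x = (n, p)" "1 \<le> n" "n \<le> N" "prime p" "p dvd n"
      by (auto simp: prime_factors_dvd)
    then obtain m where m: "n = p * m" by blast
    have "0 < p" using x by (simp add: prime_gt_0_nat)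
    moreover have "0 < m" using m x by (cases m) auto
    moreover have "m \<le> N" using m x \<open>0 < p\<close>
      by (metis dvd_imp_le dvd_triv_right order_trans x(2) less_le_trans zero_less_one)
    moreover have "p \<le> N div m"
      using m x \<open>0 < m\<close> by (simp add: less_eq_div_iff_mult_less_eq)
    ultimately show "(case case x of (n, p) \<Rightarrow> (n div p, p) of (m, p) \<Rightarrow> (m * p, p)) = x"
      and "(case x of (n, p) \<Rightarrow> (n div p, p)) \<in> (SIGMA m:{1..N}. primes_upto (N div m))"
      using x m by (auto simp: primes_upto_def)
  qed
  also have "\<dots> = (\<Sum>n=1..N. \<Sum>p\<in>prime_factors n. h p (n div p))"
    by (rule sum.Sigma[symmetric]) auto
  finally show ?thesis .
qed

text \<open>
  If \<open>p\<close> divides \<open>n\<close> exactly once, then \<open>f n = f p * f (n div p)\<close> and the defect vanishes; so only prime powers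
  with exponent at least \<open>2\<close> enter.
\<close>

lemma multiplicative_log_defect_le:
  assumes f: "multiplicative_seq f" and n: "0 < n" and p: "p \<in> prime_factors n"
  defines "v \<equiv> multiplicity p n"
  shows "\<bar>ln (real p) * (real v * f n - f p * f (n div p))\<bar>
      \<le> (if 2 \<le> v then prime_power_weight f p v * \<bar>f (n div p ^ v)\<bar> else 0)"
proof -
  have pr: "prime p" "p dvd n" using p by auto
  have p0: "0 < p" using pr by (simp add: prime_gt_0_nat)
  have v: "1 \<le> v" unfolding v_def using pr n by (simp add: prime_multiplicity_gt_zero_iff Suc_leI)
  obtain m where m: "n = p ^ v * m" "\<not> p dvd m"
    unfolding v_def using multiplicity_decompose'[of n p] n pr not_prime_unit by blast
  have "0 < m" using m n by (cases m) auto
  have cop: "coprime (p ^ j) m" for j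
    using pr m by (simp add: prime_imp_coprime)
  have mult: "f (p ^ j * m) = f (p ^ j) * f m" for j
    using f cop[of j] \<open>0 < m\<close> p0 unfolding multiplicative_seq_def by simp
  have div1: "n div p = p ^ (v - 1) * m"
  proof -
    have "n = p * (p ^ (v - 1) * m)"
      using m v by (cases v) auto
    then show ?thesis using p0 by simp
  qed
  have divv: "n div p ^ v = m" using m p0 by simp
  have fn: "f n = f (p ^ v) * f m" using m(1) mult by simp
  have fn1: "f (n div p) = f (p ^ (v - 1)) * f m" using div1 mult by simp
  show ?thesis
  proof (cases "2 \<le> v")
    case False
    then have "v = 1" using v by simp
    then have "f n = f p * f m" using fn by simp
    moreover have "f (n div p) = f m" using div1 \<open>v = 1\<close> by simp
    ultimately show ?thesis using \<open>v = 1\<close> by simp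
  next
    case True
    have "\<bar>real v * f n - f p * f (n div p)\<bar> \<le> \<bar>real v * f n\<bar> + \<bar>f p * f (n div p)\<bar>"
      by (rule abs_triangle_ineq4)
    also have "\<dots> = (real v * \<bar>f (p ^ v)\<bar> + \<bar>f p\<bar> * \<bar>f (p ^ (v - 1))\<bar>) * \<bar>f m\<bar>"
      by (simp add: fn fn1 abs_mult algebra_simps)
    finally have "ln (real p) * \<bar>real v * f n - f p * f (n div p)\<bar>
        \<le> ln (real p) * ((real v * \<bar>f (p ^ v)\<bar> + \<bar>f p\<bar> * \<bar>f (p ^ (v - 1))\<bar>) * \<bar>f m\<bar>)"
      using p0 by (intro mult_left_mono) auto
    then show ?thesis
      using True p0 unfolding divv prime_power_weight_def by (simp add: abs_mult mult.assoc)
  qed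
qed

text \<open>
  Both sums are sums over \<open>n \<le> N\<close> and the prime divisors \<open>p\<close> of \<open>n\<close>, and their difference is the sum of the
  defects just bounded. The pair \<open>(n, p)\<close> is then encoded by the exact power \<open>p ^ k\<close> dividing \<open>n\<close> and the
  cofactor \<open>m = n / p ^ k\<close>.
\<close>

lemma log_weighted_sum_error_le:
  assumes f: "multiplicative_seq f"
  shows "\<bar>(\<Sum>n=1..N. f n * ln (real n))
        - (\<Sum>m=1..N. f m * (\<Sum>p\<in>primes_upto (N div m). f p * ln (real p)))\<bar>
      \<le> (\<Sum>(p, k)\<in>higher_prime_powers_upto N. prime_power_weight f p k * abs_sum f (N div p ^ k))"
proof -
  define g where "g n p = ln (real p) * (real (multiplicity p n) * f n - f p * f (n div p))" for n p
  define T where "T = (SIGMA n:{1..N}. prime_factors n)"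
  have finT: "finite T" unfolding T_def by (intro finite_SigmaI) auto
  have "(\<Sum>n=1..N. f n * ln (real n))
      = (\<Sum>n=1..N. \<Sum>p\<in>prime_factors n. f n * (real (multiplicity p n) * ln (real p)))"
    by (intro sum.cong) (auto simp: ln_eq_sum_prime_factors sum_distrib_left)
  moreover have "(\<Sum>m=1..N. f m * (\<Sum>p\<in>primes_upto (N div m). f p * ln (real p)))
      = (\<Sum>n=1..N. \<Sum>p\<in>prime_factors n. f (n div p) * (f p * ln (real p)))"
    unfolding sum_distrib_left by (rule sum_over_prime_cofactor)
  ultimately have "(\<Sum>n=1..N. f n * ln (real n))
        - (\<Sum>m=1..N. f m * (\<Sum>p\<in>primes_upto (N div m). f p * ln (real p)))
      = (\<Sum>n=1..N. \<Sum>p\<in>prime_factors n. g n p)"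
    by (simp only: sum_subtractf[symmetric]) (simp add: g_def algebra_simps)
  also have "\<dots> = (\<Sum>(n, p)\<in>T. g n p)"
    unfolding T_def by (rule sum.Sigma) auto
  finally have "\<bar>(\<Sum>n=1..N. f n * ln (real n))
        - (\<Sum>m=1..N. f m * (\<Sum>p\<in>primes_upto (N div m). f p * ln (real p)))\<bar>
      \<le> (\<Sum>(n, p)\<in>T. \<bar>g n p\<bar>)"
    using sum_abs[of "\<lambda>(n, p). g n p" T] by (simp add: case_prod_unfold)
  also have "\<dots> \<le> (\<Sum>(n, p)\<in>T. if 2 \<le> multiplicity p n
      then prime_power_weight f p (multiplicity p n) * \<bar>f (n div p ^ multiplicity p n)\<bar> else 0)"
  proof (rule sum_mono, clarify)
    fix n p assume "(n, p) \<in> T"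
    then show "\<bar>g n p\<bar> \<le> (if 2 \<le> multiplicity p n
      then prime_power_weight f p (multiplicity p n) * \<bar>f (n div p ^ multiplicity p n)\<bar> else 0)"
      unfolding g_def T_def by (intro multiplicative_log_defect_le[OF f]) auto
  qed
  also have "\<dots> = (\<Sum>(n, p)\<in>{(n, p) \<in> T. 2 \<le> multiplicity p n}.
      prime_power_weight f p (multiplicity p n) * \<bar>f (n div p ^ multiplicity p n)\<bar>)"
    using finT by (intro sum.mono_neutral_cong_right) (auto split: if_splits)
  also have "\<dots> \<le> (\<Sum>((p, k), m)\<in>(SIGMA (p, k):higher_prime_powers_upto N. {1..N div p ^ k}).
      prime_power_weight f p k * \<bar>f m\<bar>)"
  proof (rule sum_le_included[where i = "\<lambda>((p, k), m). (p ^ k * m, p)"])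
    show "finite {(n, p) \<in> T. 2 \<le> multiplicity p n}"
      using finT by (rule rev_finite_subset) auto
    show "finite (SIGMA (p, k):higher_prime_powers_upto N. {1..N div p ^ k})"
      using finite_higher_prime_powers_upto by (intro finite_SigmaI) auto
    show "\<forall>y\<in>SIGMA (p, k):higher_prime_powers_upto N. {1..N div p ^ k}.
        0 \<le> (\<lambda>((p, k), m). prime_power_weight f p k * \<bar>f m\<bar>) y"
      by (auto simp: higher_prime_powers_upto_def prime_power_weight_def prime_gt_0_nat Suc_leI)
    show "\<forall>x\<in>{(n, p) \<in> T. 2 \<le> multiplicity p n}.
        \<exists>y\<in>SIGMA (p, k):higher_prime_powers_upto N. {1..N div p ^ k}.
          (\<lambda>((p, k), m). (p ^ k * m, p)) y = x \<and>
          (\<lambda>(n, p). prime_power_weight f p (multiplicity p n) * \<bar>f (n div p ^ multiplicity p n)\<bar>) x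
          \<le> (\<lambda>((p, k), m). prime_power_weight f p k * \<bar>f m\<bar>) y"
    proof
      fix x assume "x \<in> {(n, p) \<in> T. 2 \<le> multiplicity p n}"
      then obtain n p where x: "x = (n, p)" "1 \<le> n" "n \<le> N" "prime p" "2 \<le> multiplicity p n"
        by (auto simp: T_def)
      define k where "k = multiplicity p n"
      have dvd: "p ^ k dvd n" unfolding k_def by (rule multiplicity_dvd)
      have pk: "0 < p ^ k" using x by (simp add: prime_gt_0_nat)
      have "p ^ k \<le> n" using dvd x by (intro dvd_imp_le) auto
      then have "((p, k), n div p ^ k) \<in> (SIGMA (p, k):higher_prime_powers_upto N. {1..N div p ^ k})"
        using x pk unfolding higher_prime_powers_upto_def k_def
        by (auto simp: div_le_mono div_greater_zero_iff Suc_le_eq)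
      then show "\<exists>y\<in>SIGMA (p, k):higher_prime_powers_upto N. {1..N div p ^ k}.
          (\<lambda>((p, k), m). (p ^ k * m, p)) y = x \<and>
          (\<lambda>(n, p). prime_power_weight f p (multiplicity p n) * \<bar>f (n div p ^ multiplicity p n)\<bar>) x
          \<le> (\<lambda>((p, k), m). prime_power_weight f p k * \<bar>f m\<bar>) y"
        using dvd x by (intro bexI[of _ "((p, k), n div p ^ k)"]) (auto simp: k_def)
    qed
  qed
  also have "\<dots> = (\<Sum>x\<in>higher_prime_powers_upto N. \<Sum>m=1..N div fst x ^ snd x.
      prime_power_weight f (fst x) (snd x) * \<bar>f m\<bar>)"
    by (subst sum.Sigma) (auto simp: case_prod_unfold finite_higher_prime_powers_upto)
  also have "\<dots> = (\<Sum>(p, k)\<in>higher_prime_powers_upto N. prime_power_weight f p k * abs_sum f (N div p ^ k))"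
    by (simp add: abs_sum_def sum_distrib_left case_prod_unfold)
  finally show ?thesis .
qed

section \<open>Convergence of the prime power weights\<close>

text \<open>
  The growth condition gives \<open>\<bar>a (p ^ j)\<bar> \<le> 2 s ^ (j - 1)\<close> with \<open>s = sqrt p\<close> for all \<open>j \<ge> 1\<close>, while \<open>p ^ k = s ^ (2 k)\<close>.
  The surplus \<open>s ^ (k + 1)\<close> is divided into \<open>s ^ 3\<close>, which makes the sum over \<open>p\<close> converge, and
  \<open>s ^ (k - 2) \<ge> (sqrt 2) ^ (k - 2)\<close>, which makes the sum over \<open>k\<close> converge.
\<close>

lemma prime_power_weight_bound:
  assumes st: "sato_tate_distributed a" and gr: "prime_power_growth a"
    and p: "prime p" and k: "2 \<le> k"
  shows "prime_power_weight a p k / real (p ^ k)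
      \<le> (ln (real p) / real p powr (3 / 2)) * (4 * real k * (1 / sqrt 2) ^ (k - 2))"
proof -
  define s where "s = sqrt (real p)"
  have p2: "2 \<le> p" using p by (rule prime_ge_2_nat)
  have "sqrt 2 \<le> s" using p2 by (simp add: s_def)
  moreover have "1 < sqrt (2 :: real)" by simp
  ultimately have s: "sqrt 2 \<le> s" "1 \<le> s" "0 < s" by linarith+
  have bound: "\<bar>a (p ^ j)\<bar> \<le> 2 * s ^ (j - 1)" if "1 \<le> j" for j
  proof (cases "j = 1")
    case True
    then show ?thesis using sato_tate_bounded[OF st p] by simp
  next
    case False
    with that have j: "2 \<le> j" by simp
    obtain \<rho> where "0 < \<rho>" and
      "\<bar>a (p ^ j)\<bar> \<le> real p powr ((real j - 1) / 2 - \<rho>)"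
      using gr j p unfolding prime_power_growth_def by blast
    note this(2)
    also have "\<dots> \<le> real p powr ((real j - 1) / 2)"
    proof (rule powr_mono)
      show "(real j - 1) / 2 - \<rho> \<le> (real j - 1) / 2" using \<open>0 < \<rho>\<close> by linarith
    qed (use p2 in simp)
    also have "\<dots> = s ^ (j - 1)"
    proof -
      have "s ^ (j - 1) = s powr real (j - 1)" using s by (simp add: powr_realpow)
      also have "\<dots> = real p powr ((real j - 1) / 2)"
        using j by (simp add: s_def powr_half_sqrt[symmetric] powr_powr of_nat_diff)
      finally show ?thesis by simp
    qed
    also have "\<dots> \<le> 2 * s ^ (j - 1)" using s by simp
    finally show ?thesis .
  qed
  have "real k * \<bar>a (p ^ k)\<bar> + \<bar>a p\<bar> * \<bar>a (p ^ (k - 1))\<bar>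
      \<le> real k * (2 * s ^ (k - 1)) + 2 * (2 * s ^ (k - 1))"
  proof (intro add_mono mult_mono)
    show "\<bar>a (p ^ k)\<bar> \<le> 2 * s ^ (k - 1)" using bound[of k] k by simp
    have "\<bar>a (p ^ (k - 1))\<bar> \<le> 2 * s ^ (k - 1 - 1)" using bound[of "k - 1"] k by simp
    also have "\<dots> \<le> 2 * s ^ (k - 1)" using s by (intro mult_left_mono power_increasing) auto
    finally show "\<bar>a (p ^ (k - 1))\<bar> \<le> 2 * s ^ (k - 1)" .
  qed (use sato_tate_bounded[OF st p] s in auto)
  also have "\<dots> \<le> 4 * real k * s ^ (k - 1)"
  proof -
    have "(2 * real k + 4) * s ^ (k - 1) \<le> (4 * real k) * s ^ (k - 1)"
      using k s by (intro mult_right_mono) auto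
    then show ?thesis by (simp add: algebra_simps)
  qed
  finally have "prime_power_weight a p k \<le> ln (real p) * (4 * real k * s ^ (k - 1))"
    unfolding prime_power_weight_def using p2 by (intro mult_left_mono) auto
  then have "prime_power_weight a p k / real (p ^ k) \<le> ln (real p) * (4 * real k * s ^ (k - 1)) / real (p ^ k)"
    by (rule divide_right_mono) simp
  also have "ln (real p) * (4 * real k * s ^ (k - 1)) / real (p ^ k)
      = (ln (real p) / s ^ 3) * (4 * real k * (1 / s) ^ (k - 2))"
  proof -
    have "real (p ^ k) = (s ^ 2) ^ k" by (simp add: s_def)
    also have "\<dots> = s ^ ((k - 1) + (3 + (k - 2)))"
      unfolding power_mult[symmetric] using k by (intro arg_cong[where f = "\<lambda>n. s ^ n"]) simp
    finally have "real (p ^ k) = s ^ (k - 1) * (s ^ 3 * s ^ (k - 2))" by (simp only: power_add)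
    then show ?thesis using s by (simp add: power_divide)
  qed
  also have "\<dots> \<le> (ln (real p) / s ^ 3) * (4 * real k * (1 / sqrt 2) ^ (k - 2))"
    using s p2 by (intro mult_left_mono power_mono divide_left_mono) auto
  finally have "prime_power_weight a p k / real (p ^ k)
      \<le> (ln (real p) / s ^ 3) * (4 * real k * (1 / sqrt 2) ^ (k - 2))" .
  moreover have "s ^ 3 = real p powr (3 / 2)"
  proof -
    have "s ^ 3 = s powr 3" using s by (simp add: powr_numeral)
    also have "\<dots> = real p powr (3 / 2)"
      by (simp add: s_def powr_half_sqrt[symmetric] powr_powr)
    finally show ?thesis .
  qed
  ultimately show ?thesis by simp
qed

lemma summable_ln_over_powr_three_halves: "summable (\<lambda>n. ln (real n) / real n powr (3 / 2))"
proof (rule summable_comparison_test)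
  show "\<exists>M. \<forall>n\<ge>M. norm (ln (real n) / real n powr (3 / 2)) \<le> 4 * real n powr (- (5 / 4))"
  proof (intro exI[of _ 1] allI impI)
    fix n :: nat assume n: "1 \<le> n"
    have "ln (real n) \<le> real n powr (1 / 4) / (1 / 4)"
      using n by (intro ln_powr_bound) auto
    then have "ln (real n) / real n powr (3 / 2) \<le> (4 * real n powr (1 / 4)) / real n powr (3 / 2)"
      by (intro divide_right_mono) auto
    also have "\<dots> = 4 * (real n powr (1 / 4) / real n powr (3 / 2))" by simp
    also have "real n powr (1 / 4) / real n powr (3 / 2) = real n powr (1 / 4 - 3 / 2)"
      by (rule powr_diff[symmetric])
    also have "1 / 4 - 3 / 2 = (- (5 / 4) :: real)" by simp
    finally show "norm (ln (real n) / real n powr (3 / 2)) \<le> 4 * real n powr (- (5 / 4))"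
      using n by simp
  qed
  show "summable (\<lambda>n. 4 * real n powr (- (5 / 4)))"
    using summable_real_powr_iff[of "- (5 / 4)"] by (intro summable_mult) simp
qed

lemma summable_of_nat_times_power:
  fixes r :: real
  assumes "\<bar>r\<bar> < 1"
  shows "summable (\<lambda>k. real k * r ^ k)"
proof -
  have "summable (\<lambda>k. r * (real (Suc k) * r ^ k))"
    using geometric_deriv_sums[of r] assms by (intro summable_mult) (auto simp: sums_iff)
  then have "summable (\<lambda>k. real (Suc k) * r ^ Suc k)"
    by (simp add: mult.left_commute mult.assoc)
  then show ?thesis by (subst (asm) summable_Suc_iff)
qed

lemma sum_prime_power_weights_bounded:
  assumes st: "sato_tate_distributed a" and gr: "prime_power_growth a"
  shows "\<exists>B. \<forall>F. finite F \<longrightarrow> F \<subseteq> {(p, k). prime p \<and> 2 \<le> k} \<longrightarrow>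
           (\<Sum>(p, k)\<in>F. prime_power_weight a p k / real (p ^ k)) \<le> B"
proof -
  define U where "U p = ln (real p) / real p powr (3 / 2)" for p :: nat
  define V where "V k = 8 * (real k * (1 / sqrt 2) ^ k)" for k :: nat
  have U: "summable U" unfolding U_def by (rule summable_ln_over_powr_three_halves)
  have V: "summable V" unfolding V_def
    by (intro summable_mult summable_of_nat_times_power) simp
  have U0: "0 \<le> U p" for p
    unfolding U_def by (cases "p = 0") auto
  have V0: "0 \<le> V k" for k by (simp add: V_def)
  have "(\<Sum>(p, k)\<in>F. prime_power_weight a p k / real (p ^ k)) \<le> suminf U * suminf V"
    if F: "finite F" "F \<subseteq> {(p, k). prime p \<and> 2 \<le> k}" for F
  proof -
    have "(\<Sum>(p, k)\<in>F. prime_power_weight a p k / real (p ^ k)) \<le> (\<Sum>(p, k)\<in>F. U p * V k)"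
    proof (rule sum_mono, clarify)
      fix p k assume "(p, k) \<in> F"
      then have pk: "prime p" "2 \<le> k" using F by auto
      have "r ^ k = r ^ (k - 2) * r ^ 2" for r :: real
        using power_add[of r "k - 2" 2] pk by (simp only: le_add_diff_inverse2)
      from this[of "1 / sqrt 2"] have "(1 / sqrt 2) ^ k = (1 / sqrt 2) ^ (k - 2) * (1 / 2 :: real)"
        by (simp only: power_divide real_sqrt_pow2) simp
      then have "V k = 4 * real k * (1 / sqrt 2) ^ (k - 2)"
        unfolding V_def by simp
      then show "prime_power_weight a p k / real (p ^ k) \<le> U p * V k"
        using prime_power_weight_bound[OF st gr pk] by (simp only: U_def)
    qed
    also have "\<dots> \<le> (\<Sum>(p, k)\<in>fst ` F \<times> snd ` F. U p * V k)"
      using F U0 V0 by (intro sum_mono2 subset_fst_snd) auto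
    also have "\<dots> = sum U (fst ` F) * sum V (snd ` F)"
      unfolding sum_product by (rule sum.cartesian_product[symmetric])
    also have "\<dots> \<le> suminf U * suminf V"
      using F U V U0 V0 by (intro mult_mono sum_le_suminf suminf_nonneg sum_nonneg) auto
    finally show ?thesis .
  qed
  then show ?thesis by blast
qed

lemma negligible_for_higher_prime_powers:
  assumes st: "sato_tate_distributed a" and gr: "prime_power_growth a"
  shows "negligible_for a (\<lambda>N. \<Sum>(p, k)\<in>higher_prime_powers_upto N.
           prime_power_weight a p k * abs_sum a (N div p ^ k))"
proof -
  obtain B where B: "\<And>F. finite F \<Longrightarrow> F \<subseteq> {(p, k). prime p \<and> 2 \<le> k} \<Longrightarrow>
      (\<Sum>(p, k)\<in>F. prime_power_weight a p k / real (p ^ k)) \<le> B"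
    using sum_prime_power_weights_bounded[OF assms] by blast
  have "negligible_for a (\<lambda>N. \<Sum>x\<in>higher_prime_powers_upto N.
      (case x of (p, k) \<Rightarrow> prime_power_weight a p k) * abs_sum a (N div (case x of (p, k) \<Rightarrow> p ^ k)))"
  proof (rule negligible_for_dilations[where I = "{(p, k). prime p \<and> 2 \<le> k}" and B = B])
    fix F :: "(nat \<times> nat) set"
    assume "finite F" "F \<subseteq> {(p, k). prime p \<and> 2 \<le> k}"
    from B[OF this] show "(\<Sum>i\<in>F. (case i of (p, k) \<Rightarrow> prime_power_weight a p k)
        / real (case i of (p, k) \<Rightarrow> p ^ k)) \<le> B"
      by (simp add: case_prod_unfold)
  next
    show "finite (higher_prime_powers_upto N)" for N
      by (rule finite_higher_prime_powers_upto)
  qed (auto simp: higher_prime_powers_upto_def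
         prime_power_weight_def prime_gt_0_nat Suc_leI)
  then show ?thesis by (simp add: case_prod_unfold)
qed

section \<open>Comparison of the sum with the sum of absolute values\<close>

lemma multiplicative_seq_abs:
  "multiplicative_seq a \<Longrightarrow> multiplicative_seq (\<lambda>n. \<bar>a n\<bar>)"
  by (simp add: multiplicative_seq_def abs_mult)

text \<open>
  Since \<open>ln N = ln n + ln (N / n)\<close>, the left-hand side is the convolution with the prime sums \<open>E\<close>, plus the error in the
  logarithmic identity, plus a sum weighted by \<open>ln (N / n)\<close>; each is negligible.
\<close>

lemma negligible_for_sum_times_log:
  assumes mult: "multiplicative_seq a" and st: "sato_tate_distributed a" and gr: "prime_power_growth a"
  shows "negligible_for a (\<lambda>N. (\<Sum>n=1..N. a n) * ln (real N))"
proof -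
  define E where "E k = (\<Sum>p\<in>primes_upto k. a p * ln (real p))" for k
  have conv: "negligible_for a (\<lambda>N. \<Sum>m=1..N. a m * E (N div m))"
  proof (rule negligible_for_convolution)
    fix \<epsilon> :: real assume "0 < \<epsilon>"
    then obtain C where C: "C \<ge> 0" "\<And>k. \<bar>E k\<bar> \<le> \<epsilon> * real k + C"
      using sato_tate_weighted_mean_zero[OF st] unfolding E_def by meson
    have "\<bar>E (N div m)\<bar> \<le> \<epsilon> * (real N / real m) + C" for N m
    proof -
      have "\<epsilon> * real (N div m) \<le> \<epsilon> * (real N / real m)"
        using \<open>0 < \<epsilon>\<close> by (intro mult_left_mono of_nat_div_le_of_nat) auto
      then show ?thesis using C(2)[of "N div m"] by linarith
    qed
    then show "\<exists>C\<ge>0. \<forall>N. \<forall>m\<in>{1..N}. \<bar>E (N div m)\<bar> \<le> \<epsilon> * (real N / real m) + C"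
      using C(1) by blast
  qed
  have err: "negligible_for a (\<lambda>N. (\<Sum>n=1..N. a n * ln (real n)) - (\<Sum>m=1..N. a m * E (N div m)))"
    by (rule negligible_for_mono[OF negligible_for_higher_prime_powers[OF st gr]])
       (use log_weighted_sum_error_le[OF mult] in \<open>auto simp: E_def intro: order_trans[OF _ abs_ge_self]\<close>)
  have quot: "negligible_for a (\<lambda>N. \<Sum>n=1..N. a n * ln (real N / real n))"
  proof (rule negligible_for_convolution)
    fix \<epsilon> :: real assume "0 < \<epsilon>"
    have "\<bar>ln (real N / real n)\<bar> \<le> \<epsilon> * (real N / real n) + \<bar>ln \<epsilon>\<bar>" if "n \<in> {1..N}" for N n
      using ln_le_linear[OF \<open>0 < \<epsilon>\<close>, of "real N / real n"] that by simp
    then show "\<exists>C\<ge>0. \<forall>N. \<forall>n\<in>{1..N}. \<bar>ln (real N / real n)\<bar> \<le> \<epsilon> * (real N / real n) + C"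
      by (intro exI[of _ "\<bar>ln \<epsilon>\<bar>"]) auto
  qed
  have "(\<Sum>n=1..N. a n) * ln (real N)
      = ((\<Sum>n=1..N. a n * ln (real n)) - (\<Sum>m=1..N. a m * E (N div m)))
        + (\<Sum>m=1..N. a m * E (N div m)) + (\<Sum>n=1..N. a n * ln (real N / real n))" for N
  proof -
    have "(\<Sum>n=1..N. a n * ln (real n)) + (\<Sum>n=1..N. a n * ln (real N / real n))
        = (\<Sum>n=1..N. a n * ln (real N))"
      unfolding sum.distrib[symmetric]
      by (intro sum.cong) (auto simp: ln_div algebra_simps)
    then show ?thesis by (simp add: sum_distrib_right)
  qed
  then show ?thesis
    using negligible_for_add[OF negligible_for_add[OF err conv] quot] by simp
qed

text \<open>
  The logarithmic identity for \<open>\<bar>a\<bar>\<close>, read as a lower bound: its error is at most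
  \<open>(c / 2) N L(N) + C A(N)\<close>, so half of the main term \<open>c N L(N)\<close> survives.
\<close>

lemma abs_log_sum_le:
  assumes mult: "multiplicative_seq a" and st: "sato_tate_distributed a" and gr: "prime_power_growth a"
  shows "\<exists>K>0. \<forall>N\<ge>1. real N * abs_log_sum a N \<le> K * (ln (real N) + 1) * abs_sum a N"
proof -
  define D where "D k = (\<Sum>p\<in>primes_upto k. \<bar>a p\<bar> * ln (real p))" for k
  define R where "R N = (\<Sum>(p, k)\<in>higher_prime_powers_upto N.
      prime_power_weight a p k * abs_sum a (N div p ^ k))" for N
  obtain c C where c: "0 < c" "0 \<le> C" "\<And>k. c * real k \<le> D k + C"
    using sato_tate_abs_lower[OF st] unfolding D_def by blast
  have "0 < c / 2" using c by simp
  then obtain C' where C': "0 \<le> C'"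
    "\<And>N. \<bar>R N\<bar> \<le> c / 2 * (real N * abs_log_sum a N) + C' * abs_sum a N"
    using negligible_for_higher_prime_powers[OF st gr] unfolding negligible_for_def R_def by meson
  have main: "c / 2 * (real N * abs_log_sum a N) \<le> (ln (real N) + (c + C + C')) * abs_sum a N"
    if "1 \<le> N" for N
  proof -
    have "c * (real N * abs_log_sum a N) - (c + C) * abs_sum a N
        = (\<Sum>m=1..N. \<bar>a m\<bar> * (c * (real N / real m) - (c + C)))"
      unfolding abs_log_sum_def abs_sum_def sum_distrib_left sum_subtractf[symmetric]
      by (intro sum.cong) (auto simp: algebra_simps)
    also have "\<dots> \<le> (\<Sum>m=1..N. \<bar>a m\<bar> * D (N div m))"
    proof (intro sum_mono mult_left_mono)
      fix m assume m: "m \<in> {1..N}"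
      have "real N / real m \<le> real (N div m) + 1" using real_of_int_floor_add_one_ge[of "real N / real m"]
        by (simp add: floor_divide_of_nat_eq)
      then have "c * (real N / real m) \<le> c * (real (N div m) + 1)"
        using c by (intro mult_left_mono) auto
      then show "c * (real N / real m) - (c + C) \<le> D (N div m)"
        using c(3)[of "N div m"] by (simp add: algebra_simps)
    qed simp
    also have "\<dots> \<le> (\<Sum>n=1..N. \<bar>a n\<bar> * ln (real n)) + R N"
    proof -
      have "R N = (\<Sum>(p, k)\<in>higher_prime_powers_upto N.
          prime_power_weight (\<lambda>n. \<bar>a n\<bar>) p k * abs_sum (\<lambda>n. \<bar>a n\<bar>) (N div p ^ k))"
        by (simp add: R_def prime_power_weight_def abs_sum_def)
      then show ?thesis
        using log_weighted_sum_error_le[OF multiplicative_seq_abs[OF mult], of N]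
        unfolding D_def by linarith
    qed
    also have "(\<Sum>n=1..N. \<bar>a n\<bar> * ln (real n)) \<le> (\<Sum>n=1..N. \<bar>a n\<bar> * ln (real N))"
      by (intro sum_mono mult_left_mono) auto
    also have "\<dots> = ln (real N) * abs_sum a N"
      unfolding abs_sum_def sum_distrib_left by (simp add: mult.commute)
    also have "R N \<le> c / 2 * (real N * abs_log_sum a N) + C' * abs_sum a N"
      using C'(2)[of N] by linarith
    finally show ?thesis by (simp add: algebra_simps)
  qed
  define K where "K = 2 / c * (1 + c + C + C')"
  have "0 < K" using c C' by (simp add: K_def)
  moreover have "real N * abs_log_sum a N \<le> K * (ln (real N) + 1) * abs_sum a N" if "1 \<le> N" for N
  proof -
    have "ln (real N) + (c + C + C') \<le> (1 + c + C + C') * (ln (real N) + 1)"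
    proof -
      have "0 \<le> (c + C + C') * ln (real N)" using c C' that by simp
      then show ?thesis by (simp add: algebra_simps)
    qed
    then have "(ln (real N) + (c + C + C')) * abs_sum a N
        \<le> (1 + c + C + C') * (ln (real N) + 1) * abs_sum a N"
      by (rule mult_right_mono) (rule abs_sum_nonneg)
    with main[OF that] have "c / 2 * (real N * abs_log_sum a N)
        \<le> (1 + c + C + C') * (ln (real N) + 1) * abs_sum a N" by linarith
    then have "2 / c * (c / 2 * (real N * abs_log_sum a N))
        \<le> 2 / c * ((1 + c + C + C') * (ln (real N) + 1) * abs_sum a N)"
      using c by (intro mult_left_mono) auto
    also have "\<dots> = K * (ln (real N) + 1) * abs_sum a N"
      by (simp only: K_def mult.assoc)
    also have "2 / c * (c / 2 * (real N * abs_log_sum a N)) = real N * abs_log_sum a N"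
      using c by simp
    finally show ?thesis .
  qed
  ultimately show ?thesis by blast
qed

text \<open>
  Negligibility is used with \<open>\<delta> = \<epsilon> / (2 K)\<close>, so that the comparison of \<open>N L(N)\<close> with \<open>A(N) ln N\<close> costs only
  \<open>\<epsilon> / 2\<close>; the additive constants are absorbed once \<open>ln N\<close> is large.
\<close>

lemma sum_le_epsilon_abs_sum:
  assumes "multiplicative_seq a" "sato_tate_distributed a" "prime_power_growth a" and "0 < \<epsilon>"
  shows "\<forall>\<^sub>F N in sequentially. \<bar>\<Sum>n=1..N. a n\<bar> \<le> \<epsilon> * abs_sum a N"
proof -
  obtain K where K: "0 < K"
    "\<And>N. 1 \<le> N \<Longrightarrow> real N * abs_log_sum a N \<le> K * (ln (real N) + 1) * abs_sum a N"
    using abs_log_sum_le[OF assms(1-3)] by blast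
  define \<delta> where "\<delta> = \<epsilon> / (2 * K)"
  have \<delta>: "0 < \<delta>" "\<delta> * K = \<epsilon> / 2" using K \<open>0 < \<epsilon>\<close> by (auto simp: \<delta>_def)
  obtain C where C: "0 \<le> C"
    "\<And>N. \<bar>(\<Sum>n=1..N. a n) * ln (real N)\<bar> \<le> \<delta> * (real N * abs_log_sum a N) + C * abs_sum a N"
    using negligible_for_sum_times_log[OF assms(1-3)] \<delta>(1) unfolding negligible_for_def by meson
  have "filterlim (\<lambda>n. ln (real n)) at_top sequentially"
    by (rule filterlim_compose[OF ln_at_top filterlim_real_sequentially])
  then have "\<forall>\<^sub>F N in sequentially. 1 + 2 * C / \<epsilon> \<le> ln (real N)"
    by (simp add: filterlim_at_top)
  then show ?thesis
    using eventually_gt_at_top[of 1]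
  proof eventually_elim
    case (elim N)
    have lnN: "0 < ln (real N)" using elim by simp
    have "\<epsilon> / 2 * (1 + 2 * C / \<epsilon>) \<le> \<epsilon> / 2 * ln (real N)"
      using \<open>0 < \<epsilon>\<close> by (intro mult_left_mono elim(1)) simp
    moreover have "\<epsilon> / 2 * (1 + 2 * C / \<epsilon>) = \<epsilon> / 2 + C"
      using \<open>0 < \<epsilon>\<close> by (simp add: distrib_left)
    ultimately have large: "\<epsilon> / 2 * (ln (real N) + 1) + C \<le> \<epsilon> * ln (real N)"
      unfolding distrib_left by linarith
    have "\<bar>\<Sum>n=1..N. a n\<bar> * ln (real N) = \<bar>(\<Sum>n=1..N. a n) * ln (real N)\<bar>"
      using lnN by (simp add: abs_mult)
    also have "\<dots> \<le> \<delta> * (real N * abs_log_sum a N) + C * abs_sum a N" by (rule C(2))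
    also have "\<dots> \<le> \<delta> * (K * (ln (real N) + 1) * abs_sum a N) + C * abs_sum a N"
      using \<delta>(1) elim(2) by (intro add_right_mono mult_left_mono K(2)) auto
    also have "\<dots> = (\<epsilon> / 2 * (ln (real N) + 1) + C) * abs_sum a N"
      unfolding \<delta>(2)[symmetric] distrib_right by (simp only: mult.assoc)
    also have "\<dots> \<le> (\<epsilon> * ln (real N)) * abs_sum a N"
      using large by (rule mult_right_mono) (rule abs_sum_nonneg)
    also have "\<dots> = (\<epsilon> * abs_sum a N) * ln (real N)"
      by (simp only: mult.assoc mult.commute[of "ln (real N)"])
    finally show ?case using lnN by (simp only: mult_le_cancel_right_pos)
  qed
qed

theorem theorem2:
  fixes a :: "nat \<Rightarrow> real"
  assumes "a \<in> A_ST"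
  shows "(\<lambda>x :: real. \<Sum>n | 1 \<le> n \<and> real n \<le> x. a n)
           \<in> o[at_top](\<lambda>x. \<Sum>n | 1 \<le> n \<and> real n \<le> x. \<bar>a n\<bar>)"
proof (rule landau_o.smallI)
  fix \<epsilon> :: real assume "0 < \<epsilon>"
  have "\<forall>\<^sub>F N in sequentially. \<bar>\<Sum>n=1..N. a n\<bar> \<le> \<epsilon> * abs_sum a N"
    using assms \<open>0 < \<epsilon>\<close> by (intro sum_le_epsilon_abs_sum) (auto simp: A_ST_def)
  moreover have "filterlim (\<lambda>x :: real. nat \<lfloor>x\<rfloor>) sequentially at_top"
    by (rule filterlim_compose[OF filterlim_nat_sequentially filterlim_floor_sequentially])
  ultimately have "\<forall>\<^sub>F x :: real in at_top. \<bar>\<Sum>n=1..nat \<lfloor>x\<rfloor>. a n\<bar> \<le> \<epsilon> * abs_sum a (nat \<lfloor>x\<rfloor>)"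
    by (rule eventually_compose_filterlim)
  then show "\<forall>\<^sub>F x :: real in at_top. norm (\<Sum>n | 1 \<le> n \<and> real n \<le> x. a n)
      \<le> \<epsilon> * norm (\<Sum>n | 1 \<le> n \<and> real n \<le> x. \<bar>a n\<bar>)"
    using eventually_ge_at_top[of 0]
  proof eventually_elim
    case (elim x)
    have iff: "real n \<le> x \<longleftrightarrow> n \<le> nat \<lfloor>x\<rfloor>" for n
      using elim(2) by (simp add: le_nat_iff le_floor_iff)
    have set: "{n. 1 \<le> n \<and> real n \<le> x} = {1..nat \<lfloor>x\<rfloor>}"
      unfolding iff by auto
    have "norm (abs_sum a (nat \<lfloor>x\<rfloor>)) = abs_sum a (nat \<lfloor>x\<rfloor>)"
      by (simp only: real_norm_def abs_of_nonneg[OF abs_sum_nonneg])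
    then show ?case
      using elim(1) unfolding set real_norm_def abs_sum_def by (simp only:)
  qed
qed

end
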